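(* Let $\theta_0=1,\theta_1,\ldots,\theta_{m-1}$ ($m\ge3$) be a unimodular partition of the unit circle, with associated maps $B,\Phi:[0,1)\to[0,1)$. Define $d:\{0,\ldots,m-1\}^2\to\{0,\ldots,m-1\}$ by $d(a,b)=a+1$ if $a<b$, and $d(a,b)=a$ otherwise. Let $x\in[0,1)$ have $B$-symbolic sequence $\mathbf{a}=a_0a_1a_2\ldots$. Then $$\Phi(x)=\frac{1}{m-1}\sum_{t=0}^\infty d(a_t,a_{t+1})\Bigl(-\frac{1}{m-1}\Bigr)^t.$$
   Context: $S^1=\{z\in\mathbb{C}:|z|=1\}$ is the boundary of the Poincar\'e disk. A pythagorean triple is $\mathbf{t}=(t_1,t_2,t_3)\in\mathbb{Z}^3$ with $t_3>0$, $\gcd(t_1,t_2,t_3)=1$, $t_1^2+t_2^2=t_3^2$; it is identified with the point $\theta=(t_1+t_2i)/t_3\in S^1\cap\mathbb{Q}(i)$. Let $L=\mathrm{diag}(1,1,-1)$ and $\langle \mathbf{x},\mathbf{y}\rangle=\mathbf{x}^\top L\mathbf{y}$. For distinct pythagorean triples $\mathbf{t},\mathbf{t}'$, the closed arc $[\mathbf{t},\mathbf{t}']$ going counterclockwise from $\mathbf{t}$ to $\mathbf{t}'$ is unimodular if $\mathbf{w}=(L\mathbf{t}'\times L\mathbf{t})/\langle\mathbf{t}',\mathbf{t}\rangle\in\mathbb{Z}^3$. A unimodular partition of $S^1$ is a counterclockwise cyclically ordered $m$-tuple $\mathbf{t}_0,\ldots,\mathbf{t}_{m-1}$ of pythagorean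 triples, $m\ge3$, such that each arc $[\mathbf{t}_a,\mathbf{t}_{a+1}]$ is unimodular (indices modulo $m$); $\theta_a\in S^1$ is the point identified with $\mathbf{t}_a$, and it is assumed that $\theta_0=1$. Let $I_a=[\theta_a,\theta_{a+1})$ be the half-open counterclockwise arc, and let $\mathscr{A}_a$ be the hyperbolic reflection of the Poincar\'e disk in the geodesic with ideal endpoints $\theta_a,\theta_{a+1}$, acting on $S^1$ by $\mathscr{A}_a*z=\frac{(\theta_a+\theta_{a+1})z-2\theta_a\theta_{a+1}}{2z-(\theta_a+\theta_{a+1})}$. The map $B:S^1\to S^1$ is $B(\sigma)=\mathscr{A}_a*\sigma$ for $\sigma\in I_a$. The circle is identified with $[0,1)$ via $\exp(2\pi i x)\leftrightarrow x$, so that $B$ is viewed as a map $[0,1)\to[0,1)$ (and $I_a\subset[0,1)$); let $T:[0,1)\to[0,1)$, $T(x)=-(m-1)x \pmod 1$. The $B$-symbolic sequence of $x$ is $\varphi(x)=a_0a_1a_2\ldots$, where $B^t(x)\in I_{a_t}$ for every $t\ge0$. $\Phi$ is the unique homeomorphism of $[0,1)$ (with the topology inherited from $\mathbb{R}$) such that $\Phi\circ B=T\circ\Phi$; explicitly $\Phi=\psi^{-1}\circ\varphi$, where $\psi(x)=a_0a_1a_2\ldots$ with $T^t(x)\in J_{a_t}$, $J_a=[a/m,(a+1)/m)$ (the maps $\varphi,\psi$ are injective with the same range in $\{0,\ldots,m-1\}^{\omega}$). *)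

theory Defs
  imports "HOL-Analysis.Analysis"
begin

section \<open>Pythagorean triples and unimodular partitions\<close>

definition pythagorean_triple :: "int ^ 3 \<Rightarrow> bool" where
  "pythagorean_triple t \<longleftrightarrow>
     t $ 3 > 0 \<and> gcd (t $ 1) (gcd (t $ 2) (t $ 3)) = 1 \<and>
     (t $ 1)\<^sup>2 + (t $ 2)\<^sup>2 = (t $ 3)\<^sup>2"

definition circle_point :: "int ^ 3 \<Rightarrow> complex" where
  "circle_point t = (of_int (t $ 1) + of_int (t $ 2) * \<i>) / of_int (t $ 3)"

definition real_vec :: "int ^ 3 \<Rightarrow> real ^ 3" where
  "real_vec t = (\<chi> i. of_int (t $ i))"

definition lorentz_matrix :: "real ^ 3 ^ 3" where
  "lorentz_matrix = vector [vector [1, 0, 0], vector [0, 1, 0], vector [0, 0, -1]]"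

definition lorentz_form :: "real ^ 3 \<Rightarrow> real ^ 3 \<Rightarrow> real" where
  "lorentz_form x y = x \<bullet> (lorentz_matrix *v y)"

text \<open>For distinct pythagorean triples the denominator below is nonzero, so this is a
  genuine integrality condition.\<close>

definition unimodular_arc :: "int ^ 3 \<Rightarrow> int ^ 3 \<Rightarrow> bool" where
  "unimodular_arc t t' \<longleftrightarrow>
     t \<noteq> t' \<and>
     (\<exists>w :: int ^ 3. real_vec w =
        (1 / lorentz_form (real_vec t') (real_vec t)) *\<^sub>R
          cross3 (lorentz_matrix *v real_vec t') (lorentz_matrix *v real_vec t))"

text \<open>Points of the unit circle are counterclockwise cyclically ordered if, travelling
  counterclockwise from the first one, they are met in the given order within a single turn.\<close>

definition ccw_ordered :: "nat \<Rightarrow> (nat \<Rightarrow> complex) \<Rightarrow> bool" where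
  "ccw_ordered m \<theta> \<longleftrightarrow> strict_mono_on {..<m} (\<lambda>a. Arg2pi (\<theta> a / \<theta> 0))"

text \<open>Only the values \<open>t 0, \<dots>, t (m - 1)\<close> are relevant. As in the standing convention,
  the first point of the partition is 1.\<close>

definition unimodular_partition :: "nat \<Rightarrow> (nat \<Rightarrow> int ^ 3) \<Rightarrow> bool" where
  "unimodular_partition m t \<longleftrightarrow>
     m \<ge> 3 \<and>
     (\<forall>a<m. pythagorean_triple (t a)) \<and>
     ccw_ordered m (\<lambda>a. circle_point (t a)) \<and>
     (\<forall>a<m. unimodular_arc (t a) (t ((a + 1) mod m))) \<and>
     circle_point (t 0) = 1"

section \<open>The map B\<close>

text \<open>The half-open counterclockwise arc from \<open>p\<close> to \<open>q\<close>, for distinct \<open>p\<close>, \<open>q\<close> on the circle.\<close>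

definition ccw_arc :: "complex \<Rightarrow> complex \<Rightarrow> complex set" where
  "ccw_arc p q = {z. cmod z = 1 \<and> Arg2pi (z / p) < Arg2pi (q / p)}"

definition partition_arc :: "nat \<Rightarrow> (nat \<Rightarrow> complex) \<Rightarrow> nat \<Rightarrow> complex set" where
  "partition_arc m \<theta> a = ccw_arc (\<theta> a) (\<theta> ((a + 1) mod m))"

text \<open>The action on the unit circle of the hyperbolic reflection in the geodesic with ideal
  endpoints \<open>p\<close>, \<open>q\<close>; inside the disk one would have to conjugate the variable, and on the
  circle this amounts to inverting it.\<close>

definition geodesic_reflection :: "complex \<Rightarrow> complex \<Rightarrow> complex \<Rightarrow> complex" where
  "geodesic_reflection p q z = ((p + q) * z - 2 * p * q) / (2 * z - (p + q))"

definition B_circle :: "nat \<Rightarrow> (nat \<Rightarrow> complex) \<Rightarrow> complex \<Rightarrow> complex" where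
  "B_circle m \<theta> z =
     (let a = (THE a. a < m \<and> z \<in> partition_arc m \<theta> a)
      in geodesic_reflection (\<theta> a) (\<theta> ((a + 1) mod m)) z)"

text \<open>The identification of \<open>[0,1)\<close> with the unit circle, and its inverse.\<close>

definition circle_exp :: "real \<Rightarrow> complex" where
  "circle_exp x = exp (2 * of_real pi * \<i> * of_real x)"

definition circle_coord :: "complex \<Rightarrow> real" where
  "circle_coord z = Arg2pi z / (2 * pi)"

definition B_map :: "nat \<Rightarrow> (nat \<Rightarrow> complex) \<Rightarrow> real \<Rightarrow> real" where
  "B_map m \<theta> x = circle_coord (B_circle m \<theta> (circle_exp x))"

definition arc_interval :: "nat \<Rightarrow> (nat \<Rightarrow> complex) \<Rightarrow> nat \<Rightarrow> real set" where
  "arc_interval m \<theta> a = {x \<in> {0..<1}. circle_exp x \<in> partition_arc m \<theta> a}"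

definition B_symbolic_sequence ::
    "nat \<Rightarrow> (nat \<Rightarrow> complex) \<Rightarrow> real \<Rightarrow> (nat \<Rightarrow> nat) \<Rightarrow> bool" where
  "B_symbolic_sequence m \<theta> x a \<longleftrightarrow>
     (\<forall>t. a t < m \<and> (B_map m \<theta> ^^ t) x \<in> arc_interval m \<theta> (a t))"

section \<open>The map T and the conjugacy\<close>

definition T_map :: "nat \<Rightarrow> real \<Rightarrow> real" where
  "T_map m x = frac (- (real m - 1) * x)"

text \<open>\<open>B\<close> and \<open>T\<close> are total functions that matter only on \<open>[0,1)\<close>. Requiring \<open>\<Phi>\<close> to be
  \<open>extensional\<close>, i.e. \<open>undefined\<close> off \<open>[0,1)\<close>, is what makes it unique as a HOL function.\<close>

definition is_conjugacy :: "nat \<Rightarrow> (nat \<Rightarrow> complex) \<Rightarrow> (real \<Rightarrow> real) \<Rightarrow> bool" where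
  "is_conjugacy m \<theta> \<Phi> \<longleftrightarrow>
     \<Phi> \<in> extensional {0..<1} \<and>
     homeomorphic_map (top_of_set {0..<1}) (top_of_set {0..<1}) \<Phi> \<and>
     (\<forall>x\<in>{0..<1}. \<Phi> (B_map m \<theta> x) = T_map m (\<Phi> x))"

definition Phi :: "nat \<Rightarrow> (nat \<Rightarrow> complex) \<Rightarrow> real \<Rightarrow> real" where
  "Phi m \<theta> = (THE \<Phi>. is_conjugacy m \<theta> \<Phi>)"

definition d :: "nat \<Rightarrow> nat \<Rightarrow> nat" where
  "d a b = (if a < b then a + 1 else a)"

end

theory Submission
  imports Defs
begin

text \<open>The map \<open>B\<close> is continuous on the circle and fixes the partition points, and it lifts to a
  strictly decreasing homeomorphism \<open>F\<close> of the line with \<open>F (x + 1) = F x - (m - 1)\<close>. Such a map is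
  semiconjugate to multiplication by \<open>- (m - 1)\<close> through the monotone function
  \<open>H x = lim F\<^sup>n x / (- (m - 1))\<^sup>n\<close>. If \<open>H\<close> were constant on an interval, that interval would contain
  two rational points; the Lorentz reflections in the sides are integral and lower the product of
  an outside null vector with the sum of the vertices of the ideal polygon, so both points reach
  partition points after finitely many steps, where \<open>H\<close> separates them. Hence \<open>H\<close> restricts to the
  conjugacy \<open>\<Phi>\<close>. Since \<open>\<lfloor>F x\<rfloor> = - d (a\<^sub>0, a\<^sub>1)\<close>, the relation \<open>H (F x) = - (m - 1) H x\<close> says
  \<open>(m - 1) \<Phi> x = d (a\<^sub>0, a\<^sub>1) - \<Phi> (B x)\<close>, which iterates to the series.\<close>

section \<open>Semiconjugacies of circle maps of negative degree\<close>

locale negative_degree_lift =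
  fixes F :: "real \<Rightarrow> real" and K :: real
  assumes K_gt_1: "K > 1"
    and K_integer: "K \<in> \<int>"
    and F_continuous: "continuous_on UNIV F"
    and F_strict_antimono: "x < y \<Longrightarrow> F y < F x"
    and F_shift_one: "F (x + 1) = F x - K"
begin

section \<open>The periodic defect and the series for \<open>H\<close>\<close>

definition defect :: "real \<Rightarrow> real" where
  "defect x = F x + K * x"

text \<open>The terms are the differences of consecutive quotients
  \<open>(F ^^ n) x * (- 1 / K) ^ n\<close>, so the series telescopes to their limit; in this form
  boundedness of \<open>defect\<close> gives uniform convergence.\<close>

definition H :: "real \<Rightarrow> real" where
  "H x = x + (\<Sum>n. defect ((F ^^ n) x) * (- 1 / K) ^ Suc n)"

lemma F_antimono: "x \<le> y \<Longrightarrow> F y \<le> F x"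
  using F_strict_antimono[of x y] by (cases "x = y") auto

lemma defect_shift_one: "defect (x + 1) = defect x"
  by (simp add: defect_def F_shift_one distrib_left)

lemma defect_shift: "defect (x + of_int n) = defect x"
proof -
  have nat_shift: "defect (y + of_nat k) = defect y" for y and k :: nat
  proof (induction k)
    case (Suc k)
    then show ?case using defect_shift_one[of "y + of_nat k"] by (simp add: add_ac)
  qed simp
  show ?thesis
  proof (cases "n \<ge> 0")
    case True
    then show ?thesis using nat_shift[of x "nat n"] by simp
  next
    case False
    then show ?thesis using nat_shift[of "x + of_int n" "nat (- n)"] by simp
  qed
qed

lemma F_shift: "F (x + of_int n) = F x - K * of_int n"
  using defect_shift[of x n] by (simp add: defect_def algebra_simps)

text \<open>By periodicity only \<open>frac x\<close> matters, and there \<open>F\<close> lies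
  between \<open>F 1\<close> and \<open>F 0\<close>.\<close>

lemma defect_bounded: "\<exists>C. \<forall>x. \<bar>defect x\<bar> \<le> C"
proof (intro exI allI)
  fix x
  have "F 1 \<le> F (frac x)" "F (frac x) \<le> F 0"
    using frac_lt_1[of x] frac_ge_0[of x] by (auto intro!: F_antimono simp del: frac_eq_0_iff)
  moreover have "0 \<le> K * frac x" "K * frac x \<le> K"
    using K_gt_1 frac_lt_1[of x] by (auto simp: mult_left_le)
  moreover have "defect x = F (frac x) + K * frac x"
    using defect_shift[of "frac x" "\<lfloor>x\<rfloor>"] by (simp add: frac_def defect_def)
  ultimately show "\<bar>defect x\<bar> \<le> \<bar>F 0\<bar> + \<bar>F 1\<bar> + K" by linarith
qed

lemma uniform_limit_H:
  "uniform_limit UNIV (\<lambda>N x. x + (\<Sum>n<N. defect ((F ^^ n) x) * (- 1 / K) ^ Suc n)) H sequentially"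
proof -
  obtain C where C: "\<And>x. \<bar>defect x\<bar> \<le> C"
    using defect_bounded by blast
  have "uniform_limit UNIV (\<lambda>N x. \<Sum>n<N. defect ((F ^^ n) x) * (- 1 / K) ^ Suc n)
      (\<lambda>x. \<Sum>n. defect ((F ^^ n) x) * (- 1 / K) ^ Suc n) sequentially"
  proof (rule Weierstrass_m_test)
    show "norm (defect ((F ^^ n) x) * (- 1 / K) ^ Suc n) \<le> C * (1 / K) ^ Suc n" for n x
      using C[of "(F ^^ n) x"] K_gt_1
      by (simp add: abs_mult power_abs divide_right_mono mult_right_mono)
    have "summable (\<lambda>n. (1 / K) ^ n)"
      using K_gt_1 by (intro summable_geometric) auto
    then show "summable (\<lambda>n. C * (1 / K) ^ Suc n)"
      by (intro summable_mult) (simp add: summable_Suc_iff del: power_Suc)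
  qed
  then show ?thesis
    unfolding H_def [abs_def] by (intro uniform_limit_add uniform_limit_const)
qed

lemma partial_sum_eq_iterate:
  "x + (\<Sum>n<N. defect ((F ^^ n) x) * (- 1 / K) ^ Suc n) = (F ^^ N) x * (- 1 / K) ^ N"
proof (induction N)
  case (Suc N)
  have "y * c + (f + K * y) * (- 1 / K * c) = f * (- 1 / K * c)" for y c f
    using K_gt_1 by (simp add: field_simps)
  with Suc show ?case
    by (simp only: sum.lessThan_Suc defect_def power_Suc funpow.simps comp_apply flip: add.assoc)
qed simp

lemma iterates_tendsto_H: "(\<lambda>N. (F ^^ N) x * (- 1 / K) ^ N) \<longlonglongrightarrow> H x"
  using tendsto_uniform_limitI[OF uniform_limit_H, of x] by (simp only: partial_sum_eq_iterate UNIV_I)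

section \<open>Functional equation, monotonicity and uniqueness of \<open>H\<close>\<close>

lemma H_functional: "H (F x) = - K * H x"
proof (rule LIMSEQ_unique)
  show "(\<lambda>N. (F ^^ N) (F x) * (- 1 / K) ^ N) \<longlonglongrightarrow> H (F x)"
    by (rule iterates_tendsto_H)
  have "(\<lambda>N. - K * ((F ^^ Suc N) x * (- 1 / K) ^ Suc N)) \<longlonglongrightarrow> - K * H x"
    by (intro tendsto_mult_left LIMSEQ_Suc iterates_tendsto_H)
  moreover have "- K * ((F ^^ Suc N) x * (- 1 / K) ^ Suc N) = (F ^^ N) (F x) * (- 1 / K) ^ N" for N
    using K_gt_1 by (simp add: funpow_swap1)
  ultimately show "(\<lambda>N. (F ^^ N) (F x) * (- 1 / K) ^ N) \<longlonglongrightarrow> - K * H x"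
    by simp
qed

lemma H_functional_iterate: "H ((F ^^ n) x) = (- K) ^ n * H x"
  by (induction n) (simp_all add: H_functional)

lemma inj_iterate: "inj (F ^^ n)"
proof (rule inj_fn)
  show "inj F"
    by (rule injI) (metis F_strict_antimono less_irrefl linorder_neqE_linordered_idom)
qed

lemma H_continuous: "continuous_on UNIV H"
proof (rule uniform_limit_theorem[OF _ uniform_limit_H])
  have F_cont: "continuous_on UNIV (F ^^ n)" for n
  proof (induction n)
    case (Suc n)
    then show ?case by (simp add: continuous_on_compose2[OF F_continuous])
  qed simp
  show "\<forall>\<^sub>F N in sequentially. continuous_on UNIV
      (\<lambda>x. x + (\<Sum>n<N. defect ((F ^^ n) x) * (- 1 / K) ^ Suc n))"
    unfolding partial_sum_eq_iterate using F_cont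
    by (intro always_eventually allI continuous_intros)
qed simp

text \<open>\<open>F\<close> reverses order and so does division by \<open>- K\<close>; hence every
  approximant is nondecreasing, and the limit inherits the inequality.\<close>

lemma H_mono: "x \<le> y \<Longrightarrow> H x \<le> H y"
proof (rule LIMSEQ_le[OF iterates_tendsto_H iterates_tendsto_H], intro exI allI impI)
  fix N
  assume "x \<le> y"
  then show "(F ^^ N) x * (- 1 / K) ^ N \<le> (F ^^ N) y * (- 1 / K) ^ N"
  proof (induction N arbitrary: x y)
    case (Suc N)
    from divide_right_mono[OF Suc.IH[OF F_antimono[OF Suc.prems]], of K] show ?case
      using K_gt_1 by (simp add: funpow_Suc_right del: funpow.simps)
  qed simp
qed

lemma iterate_shift: "(F ^^ N) (x + of_int n) = (F ^^ N) x + (- K) ^ N * of_int n"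
proof (induction N)
  case (Suc N)
  \<comment> \<open>\<open>F_shift\<close> handles integer translations only; integrality of
    \<open>K\<close> makes \<open>(- K) ^ N * of_int n\<close> one of them.\<close>
  obtain k where "K = of_int k"
    using K_integer by (auto elim: Ints_cases)
  then have "(- K) ^ N * of_int n = of_int ((- k) ^ N * n)" by simp
  then show ?case
    by (simp only: funpow.simps comp_apply Suc.IH F_shift) (simp add: \<open>K = of_int k\<close>)
qed simp

lemma H_shift: "H (x + of_int n) = H x + of_int n"
proof (rule LIMSEQ_unique[OF iterates_tendsto_H])
  have "(- K) ^ N * of_int n * (- 1 / K) ^ N = of_int n" for N
  proof -
    have "(- K) ^ N * (- 1 / K) ^ N = 1"
      using K_gt_1 by (simp flip: power_mult_distrib)
    then show ?thesis by (metis mult.assoc mult.commute mult_1)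
  qed
  then have "(F ^^ N) x * (- 1 / K) ^ N + of_int n = (F ^^ N) (x + of_int n) * (- 1 / K) ^ N" for N
    by (simp only: iterate_shift distrib_right)
  then show "(\<lambda>N. (F ^^ N) (x + of_int n) * (- 1 / K) ^ N) \<longlonglongrightarrow> H x + of_int n"
    using tendsto_add[OF iterates_tendsto_H[of x] tendsto_const[of "of_int n"]] by (simp only:)
qed

text \<open>Along an orbit \<open>G\<close> is rescaled exactly like the approximants of
  \<open>H\<close>, and its distance from the identity, at most \<open>C\<close>, is divided by
  \<open>K ^ n\<close>.\<close>

lemma H_unique:
  assumes functional: "\<And>x. G (F x) = - K * G x"
    and bounded: "\<And>x. \<bar>G x - x\<bar> \<le> C"
  shows "G x = H x"
proof (rule LIMSEQ_unique[OF _ iterates_tendsto_H])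
  have iterate: "G ((F ^^ n) x) * (- 1 / K) ^ n = G x" for n
  proof (induction n)
    case (Suc n)
    have "- K * y * (- 1 / K * c) = y * c" for y c
      using K_gt_1 by simp
    with Suc show ?case by (simp only: funpow.simps comp_apply functional power_Suc)
  qed simp
  have "(\<lambda>n. (1 / K) ^ n * C) \<longlonglongrightarrow> 0"
    using K_gt_1 by (intro tendsto_mult_left_zero LIMSEQ_realpow_zero) simp_all
  moreover have "norm ((F ^^ n) x * (- 1 / K) ^ n - G x) \<le> (1 / K) ^ n * C" for n
  proof -
    have "(F ^^ n) x * (- 1 / K) ^ n - G x = ((F ^^ n) x - G ((F ^^ n) x)) * (- 1 / K) ^ n"
      by (simp only: left_diff_distrib iterate)
    then have "norm ((F ^^ n) x * (- 1 / K) ^ n - G x)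
        = norm (((F ^^ n) x - G ((F ^^ n) x)) * (- 1 / K) ^ n)"
      by (rule arg_cong)
    also have "\<dots> = \<bar>G ((F ^^ n) x) - (F ^^ n) x\<bar> * (1 / K) ^ n"
      unfolding real_norm_def abs_mult power_abs abs_minus_commute[of "(F ^^ n) x"]
      using K_gt_1 by (simp add: abs_divide)
    also have "\<dots> \<le> (1 / K) ^ n * C"
      using K_gt_1 by (subst mult.commute) (intro mult_left_mono bounded, simp)
    finally show ?thesis .
  qed
  ultimately have "(\<lambda>n. (F ^^ n) x * (- 1 / K) ^ n - G x) \<longlonglongrightarrow> 0"
    by (metis (no_types, lifting) Lim_null_comparison always_eventually)
  then show "(\<lambda>n. (F ^^ n) x * (- 1 / K) ^ n) \<longlonglongrightarrow> G x"
    by (rule LIM_zero_cancel)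
qed

end

section \<open>Geodesic reflections in the angular coordinate\<close>

lemma circle_exp_eq_cis: "circle_exp x = cis (2 * pi * x)"
  by (simp add: circle_exp_def cis_conv_exp mult_ac)

lemma norm_circle_exp [simp]: "cmod (circle_exp x) = 1"
  by (simp add: circle_exp_eq_cis)

lemma circle_exp_nonzero [simp]: "circle_exp x \<noteq> 0"
  by (simp add: circle_exp_def)

lemma circle_exp_add: "circle_exp (x + y) = circle_exp x * circle_exp y"
  by (simp add: circle_exp_eq_cis cis_mult distrib_left)

lemma circle_exp_diff: "circle_exp (x - y) = circle_exp x / circle_exp y"
  by (simp add: circle_exp_eq_cis cis_divide right_diff_distrib)

lemma circle_exp_of_int [simp]: "circle_exp (of_int n) = 1"
  by (simp add: circle_exp_eq_cis cis_multiple_2pi)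

lemma circle_exp_shift [simp]: "circle_exp (x + of_int n) = circle_exp x"
  by (simp add: circle_exp_add)

lemma circle_exp_frac: "circle_exp (frac x) = circle_exp x"
  using circle_exp_shift[of x "- \<lfloor>x\<rfloor>"] by (simp add: frac_def)

lemma Arg2pi_circle_exp: "Arg2pi (circle_exp x) = 2 * pi * frac x"
proof (rule Arg2pi_unique)
  show "of_real 1 * exp (\<i> * of_real (2 * pi * frac x)) = circle_exp x"
    by (subst circle_exp_frac[symmetric]) (simp add: circle_exp_def mult_ac)
qed (use frac_lt_1[of x] in \<open>auto simp: frac_ge_0\<close>)

lemma circle_coord_circle_exp [simp]: "circle_coord (circle_exp x) = frac x"
  by (simp add: circle_coord_def Arg2pi_circle_exp)

lemma circle_coord_bounds: "circle_coord z \<in> {0..<1}"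
  using Arg2pi_ge_0[of z] Arg2pi_lt_2pi[of z] by (simp add: circle_coord_def field_simps)

lemma circle_exp_circle_coord: "cmod z = 1 \<Longrightarrow> circle_exp (circle_coord z) = z"
  using Arg2pi_eq[of z] by (simp add: circle_coord_def circle_exp_def mult_ac)

text \<open>Factoring out the half-sum of the angles leaves a real sine, so relations between chords
  become relations between sines.\<close>

lemma circle_exp_minus_circle_exp:
  "circle_exp x - circle_exp y = 2 * \<i> * of_real (sin (pi * (x - y))) * circle_exp ((x + y) / 2)"
proof -
  have "circle_exp x = cis (pi * (x - y)) * circle_exp ((x + y) / 2)"
    "circle_exp y = cis (- (pi * (x - y))) * circle_exp ((x + y) / 2)"
    by (simp_all add: circle_exp_eq_cis cis_mult field_simps)
  moreover have "cis u - cis (- u) = 2 * \<i> * of_real (sin u)" for u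
    by (simp add: complex_eq_iff)
  ultimately show ?thesis by (metis left_diff_distrib)
qed

lemma ccw_arc_circle_exp_iff:
  assumes "\<alpha> < \<gamma>" "\<gamma> < \<alpha> + 1"
  shows "circle_exp y \<in> ccw_arc (circle_exp \<alpha>) (circle_exp \<gamma>) \<longleftrightarrow> frac (y - \<alpha>) < \<gamma> - \<alpha>"
proof -
  have "frac (\<gamma> - \<alpha>) = \<gamma> - \<alpha>"
    using assms by (simp add: frac_eq)
  then show ?thesis
    by (simp add: ccw_arc_def Arg2pi_circle_exp flip: circle_exp_diff)
qed

section \<open>Harmonic conjugates on the circle and opposite chord ratios\<close>

lemma sin_pi_pos: "0 < u \<Longrightarrow> u < 1 \<Longrightarrow> 0 < sin (pi * u)"
  by (rule sin_gt_zero) auto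

lemma sin_pi_nonneg: "0 \<le> u \<Longrightarrow> u \<le> 1 \<Longrightarrow> 0 \<le> sin (pi * u)"
  by (rule sin_ge_zero) auto

text \<open>By the parallelogram law the midpoint of two distinct points of the circle lies strictly
  inside the disk, so the denominator of \<open>geodesic_reflection\<close> does not vanish on the
  circle.\<close>

lemma twice_neq_sum_on_circle:
  assumes "cmod p = 1" "cmod q = 1" "cmod z = 1" "p \<noteq> q"
  shows "2 * z \<noteq> p + q"
proof
  assume z: "2 * z = p + q"
  have "(cmod (p + q))\<^sup>2 + (cmod (p - q))\<^sup>2 = 2 * (cmod p)\<^sup>2 + 2 * (cmod q)\<^sup>2"
    unfolding cmod_power2 by (simp add: power2_eq_square algebra_simps)
  moreover have "cmod (p + q) = 2"
    using assms by (simp add: norm_mult flip: z)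
  ultimately show False using assms by simp
qed

text \<open>The reflection pairs the points of the circle that are harmonic conjugates with respect to
  the ideal endpoints; in the angular coordinate this makes it \<open>u \<mapsto> - u\<close> for \<open>u\<close> the ratio below.\<close>

definition chord_ratio :: "real \<Rightarrow> real \<Rightarrow> real \<Rightarrow> real" where
  "chord_ratio \<alpha> \<gamma> y = sin (pi * (y - \<alpha>)) / sin (pi * (\<gamma> - y))"

text \<open>This is harmonic conjugacy in polynomial form, which stays meaningful when
  \<open>z\<close> is one of the endpoints.\<close>

lemma geodesic_reflection_eq_iff:
  assumes "cmod p = 1" "cmod q = 1" "cmod z = 1" "p \<noteq> q"
  shows "geodesic_reflection p q z = z' \<longleftrightarrow> (z - p) * (z' - q) + (z' - p) * (z - q) = 0"
proof -
  have "2 * z - (p + q) \<noteq> 0"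
    using twice_neq_sum_on_circle[OF assms] by simp
  then have "geodesic_reflection p q z = z' \<longleftrightarrow> (p + q) * z - 2 * p * q = z' * (2 * z - (p + q))"
    by (simp add: geodesic_reflection_def nonzero_divide_eq_eq)
  also have "\<dots> \<longleftrightarrow> (z - p) * (z' - q) + (z' - p) * (z - q) = 0"
    by (auto simp: algebra_simps)
  finally show ?thesis .
qed

lemma geodesic_reflection_circle_exp:
  assumes "\<alpha> < \<gamma>" "\<gamma> < \<alpha> + 1"
    and y: "\<gamma> - 1 < y" "y < \<gamma>" and r: "\<gamma> - 1 < r" "r < \<gamma>"
    and ratio: "chord_ratio \<alpha> \<gamma> r = - chord_ratio \<alpha> \<gamma> y"
  shows "geodesic_reflection (circle_exp \<alpha>) (circle_exp \<gamma>) (circle_exp y) = circle_exp r"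
proof -
  have "circle_exp \<alpha> \<noteq> circle_exp \<gamma>"
    using assms(1,2) circle_exp_minus_circle_exp[of \<gamma> \<alpha>] sin_pi_pos[of "\<gamma> - \<alpha>"] by auto
  have "sin (pi * (\<gamma> - y)) > 0" "sin (pi * (\<gamma> - r)) > 0"
    using y r by (auto intro!: sin_pi_pos)
  then have "sin (pi * (y - \<alpha>)) * sin (pi * (\<gamma> - r)) + sin (pi * (r - \<alpha>)) * sin (pi * (\<gamma> - y)) = 0"
    using ratio by (simp add: chord_ratio_def field_simps)
  then have "complex_of_real (sin (pi * (y - \<alpha>))) * of_real (sin (pi * (\<gamma> - r)))
      + of_real (sin (pi * (r - \<alpha>))) * of_real (sin (pi * (\<gamma> - y))) = 0"
    by (metis of_real_0 of_real_add of_real_mult)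
  \<comment> \<open>The two products of chords carry the same phase, since the half-sums have the
    same total; only the sine relation is left.\<close>
  moreover have "circle_exp ((y + \<alpha>) / 2) * circle_exp ((\<gamma> + r) / 2)
      = circle_exp ((r + \<alpha>) / 2) * circle_exp ((\<gamma> + y) / 2)"
    by (simp add: add_divide_distrib add_ac flip: circle_exp_add)
  ultimately have "(circle_exp y - circle_exp \<alpha>) * (circle_exp \<gamma> - circle_exp r)
      + (circle_exp r - circle_exp \<alpha>) * (circle_exp \<gamma> - circle_exp y) = 0"
    unfolding circle_exp_minus_circle_exp by algebra
  then have "(circle_exp y - circle_exp \<alpha>) * (circle_exp r - circle_exp \<gamma>)
      + (circle_exp r - circle_exp \<alpha>) * (circle_exp y - circle_exp \<gamma>) = 0"
    by (simp add: algebra_simps)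
  then show ?thesis
    using \<open>circle_exp \<alpha> \<noteq> circle_exp \<gamma>\<close> by (subst geodesic_reflection_eq_iff) auto
qed

text \<open>Once the positive denominators are cleared, a product identity for sines turns the
  difference into \<open>sin (pi * (\<gamma> - \<alpha>)) * sin (pi * (z - y))\<close>.\<close>

lemma chord_ratio_strict_mono:
  assumes "\<alpha> < \<gamma>" "\<gamma> < \<alpha> + 1" "\<gamma> - 1 < y" "y < z" "z < \<gamma>"
  shows "chord_ratio \<alpha> \<gamma> y < chord_ratio \<alpha> \<gamma> z"
proof -
  have pos: "sin (pi * (\<gamma> - y)) > 0" "sin (pi * (\<gamma> - z)) > 0" "sin (pi * (\<gamma> - \<alpha>)) > 0" "sin (pi * (z - y)) > 0"
    using assms by (auto intro!: sin_pi_pos)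
  have "sin (a + b + c) * sin b = sin (a + b) * sin (b + c) - sin a * sin c" for a b c :: real
  proof -
    have *: "(sin b)\<^sup>2 = 1 - (cos b)\<^sup>2" by (simp add: sin_squared_eq)
    show ?thesis
      unfolding sin_add cos_add using * by algebra
  qed
  from this[of "pi * (y - \<alpha>)" "pi * (z - y)" "pi * (\<gamma> - z)"]
  have "sin (pi * (\<gamma> - \<alpha>)) * sin (pi * (z - y))
      = sin (pi * (z - \<alpha>)) * sin (pi * (\<gamma> - y)) - sin (pi * (y - \<alpha>)) * sin (pi * (\<gamma> - z))"
    by (simp add: algebra_simps)
  then show ?thesis
    using mult_pos_pos[OF pos(3,4)] pos by (simp add: chord_ratio_def divide_simps)
qed

lemma chord_ratio_left [simp]: "chord_ratio \<alpha> \<gamma> \<alpha> = 0"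
  by (simp add: chord_ratio_def)

text \<open>\<open>S\<close> is the equation with denominators cleared, so the intermediate value
  theorem applies up to \<open>\<gamma> - 1\<close>, where the ratio has a pole; the sign of
  \<open>S\<close> there excludes that endpoint.\<close>

lemma ex_opposite_chord_ratio:
  assumes "\<alpha> < \<gamma>" "\<gamma> < \<alpha> + 1" "\<alpha> \<le> y" "y < \<gamma>"
  shows "\<exists>r. \<gamma> - 1 < r \<and> r \<le> \<alpha> \<and> chord_ratio \<alpha> \<gamma> r = - chord_ratio \<alpha> \<gamma> y"
proof -
  define S where "S r = sin (pi * (y - \<alpha>)) * sin (pi * (\<gamma> - r)) + sin (pi * (r - \<alpha>)) * sin (pi * (\<gamma> - y))" for r
  have "sin (pi * (\<gamma> - 1 - \<alpha>)) = - sin (pi * (\<gamma> - \<alpha>))"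
  proof -
    have "pi * (\<gamma> - 1 - \<alpha>) = pi * (\<gamma> - \<alpha>) - pi"
      by (simp add: algebra_simps)
    then show ?thesis by (simp only: sin_diff sin_pi cos_pi)
  qed
  then have S1: "S (\<gamma> - 1) < 0"
    using assms by (auto simp: S_def intro!: mult_pos_pos sin_pi_pos)
  have S2: "0 \<le> S \<alpha>"
    using assms by (auto simp: S_def intro!: mult_nonneg_nonneg sin_pi_nonneg)
  have "continuous_on {\<gamma> - 1..\<alpha>} S"
    unfolding S_def by (intro continuous_intros)
  then obtain r where r: "\<gamma> - 1 \<le> r" "r \<le> \<alpha>" "S r = 0"
    using IVT'[of S "\<gamma> - 1" 0 \<alpha>] S1 S2 assms by auto
  then have "r \<noteq> \<gamma> - 1" using S1 by auto
  with r have "\<gamma> - 1 < r" by simp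
  then have "sin (pi * (\<gamma> - y)) > 0" "sin (pi * (\<gamma> - r)) > 0"
    using assms r by (auto intro!: sin_pi_pos)
  then have "chord_ratio \<alpha> \<gamma> r = - chord_ratio \<alpha> \<gamma> y"
    using r(3) by (simp add: chord_ratio_def S_def field_simps)
  with r \<open>\<gamma> - 1 < r\<close> show ?thesis by blast
qed

lemma ex_opposite_chord_ratio':
  assumes "\<alpha> < \<gamma>" "\<gamma> < \<alpha> + 1" "\<gamma> - 1 < r" "r \<le> \<alpha>"
  shows "\<exists>y. \<alpha> \<le> y \<and> y < \<gamma> \<and> chord_ratio \<alpha> \<gamma> r = - chord_ratio \<alpha> \<gamma> y"
proof -
  define S where "S y = sin (pi * (y - \<alpha>)) * sin (pi * (\<gamma> - r)) - sin (pi * (\<alpha> - r)) * sin (pi * (\<gamma> - y))" for y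
  have S1: "S \<alpha> \<le> 0"
    using assms by (auto simp: S_def intro!: mult_nonneg_nonneg sin_pi_nonneg)
  have S2: "0 < S \<gamma>"
    using assms by (auto simp: S_def intro!: mult_pos_pos sin_pi_pos)
  have "continuous_on {\<alpha>..\<gamma>} S"
    unfolding S_def by (intro continuous_intros)
  then obtain y where y: "\<alpha> \<le> y" "y \<le> \<gamma>" "S y = 0"
    using IVT'[of S \<alpha> 0 \<gamma>] S1 S2 assms by auto
  then have "y \<noteq> \<gamma>" using S2 by auto
  with y have "y < \<gamma>" by simp
  then have "sin (pi * (\<gamma> - y)) > 0" "sin (pi * (\<gamma> - r)) > 0"
    using assms y by (auto intro!: sin_pi_pos)
  moreover have "sin (pi * (\<alpha> - r)) = - sin (pi * (r - \<alpha>))"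
    by (metis minus_diff_eq mult_minus_right sin_minus)
  ultimately have "chord_ratio \<alpha> \<gamma> r = - chord_ratio \<alpha> \<gamma> y"
    using y(3) by (simp add: chord_ratio_def S_def field_simps)
  with y \<open>y < \<gamma>\<close> show ?thesis by blast
qed

section \<open>Geodesic reflections as Lorentz reflections\<close>

lemma cnj_eq_inverse_if_norm_1: "cmod z = 1 \<Longrightarrow> cnj z = inverse z"
  using complex_div_cnj[of 1 z] by (simp add: divide_inverse)

text \<open>The plane over the geodesic with ideal endpoints \<open>p\<close>, \<open>q\<close> has
  Lorentz unit normal \<open>w = (w1, w2, w3)\<close>, and \<open>l\<close> is the product of
  \<open>v = (z, 1)\<close> with it. The reflection sends \<open>v\<close> to
  \<open>v - 2 * l * w\<close>; dividing by the third coordinate \<open>1 - 2 * l * w3\<close>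
  returns to the circle.\<close>

lemma
  fixes w1 w2 w3 :: real
  assumes on_circle: "cmod p = 1" "cmod q = 1" "cmod z = 1" and "p \<noteq> q"
    and w12: "Complex w1 w2 = - 2 * \<i> * p * q / (p - q)"
    and w3: "of_real w3 = - \<i> * (p + q) / (p - q)"
  defines "l \<equiv> Re z * w1 + Im z * w2 - w3"
  shows lorentz_product_normal: "of_real l = - \<i> * (z - p) * (z - q) / (z * (p - q))"
    and lorentz_reflection: "of_real (1 - 2 * l * w3) * geodesic_reflection p q z = z - 2 * of_real l * Complex w1 w2"
    and lorentz_reflection_scale_pos: "1 - 2 * l * w3 > 0"
proof -
  have nz: "p \<noteq> 0" "q \<noteq> 0" "z \<noteq> 0" "p - q \<noteq> 0"
    using assms by auto
  have cnj_w12: "cnj (Complex w1 w2) = - 2 * \<i> / (p - q)"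
    unfolding w12 using nz
    by (simp add: cnj_eq_inverse_if_norm_1 on_circle) (simp add: field_simps)
  have "of_real l = (z * cnj (Complex w1 w2) + cnj z * Complex w1 w2) / 2 - of_real w3"
    by (simp add: l_def complex_eq_iff)
  also have "\<dots> = - \<i> * (z - p) * (z - q) / (z * (p - q))"
  proof -
    have "(z * (- 2 * \<i> / s) + inverse z * (- 2 * \<i> * p * q / s)) / 2 - - \<i> * (p + q) / s
        = - \<i> * (z - p) * (z - q) / (z * s)" if "s \<noteq> 0" for s
      using nz(3) that by (simp add: field_simps)
    from this[OF nz(4)] show ?thesis
      unfolding cnj_w12 w3 unfolding w12 by (simp only: cnj_eq_inverse_if_norm_1 on_circle)
  qed
  finally show l: "of_real l = - \<i> * (z - p) * (z - q) / (z * (p - q))" .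
  have "complex_of_real (w1\<^sup>2 + w2\<^sup>2) = Complex w1 w2 * cnj (Complex w1 w2)"
    by (simp add: complex_eq_iff power2_eq_square)
  also have "\<dots> = of_real (w3\<^sup>2 + 1)"
  proof -
    have "- 2 * \<i> * p * q / s * (- 2 * \<i> / s) = (- \<i> * (p + q) / s)\<^sup>2 + 1" if "s = p - q" "s \<noteq> 0" for s
    proof -
      have "- 2 * \<i> * p * q * (- 2 * \<i>) = (- \<i> * (p + q))\<^sup>2 + s\<^sup>2"
        unfolding that(1) by (simp add: power2_eq_square algebra_simps)
      then show ?thesis
        using that(2) by (simp add: power_divide field_simps power2_eq_square)
    qed
    from this[OF refl nz(4)] show ?thesis
      unfolding of_real_add of_real_power w3 cnj_w12 unfolding w12 by simp
  qed
  finally have norm_w: "w1\<^sup>2 + w2\<^sup>2 = w3\<^sup>2 + 1"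
    by (simp only: of_real_eq_iff)
  have "(Re z)\<^sup>2 + (Im z)\<^sup>2 = 1"
    using on_circle(3) cmod_power2[of z] by simp
  \<comment> \<open>Both squares vanish only if \<open>w1^2 + w2^2 = w3^2\<close>, which contradicts
    \<open>norm_w\<close>.\<close>
  then have scale: "1 - 2 * l * w3 = (w3 * Re z - w1)\<^sup>2 + (w3 * Im z - w2)\<^sup>2"
    using norm_w unfolding l_def by algebra
  have "\<not> (w3 * Re z = w1 \<and> w3 * Im z = w2)"
    using norm_w \<open>(Re z)\<^sup>2 + (Im z)\<^sup>2 = 1\<close> by algebra
  then show pos: "1 - 2 * l * w3 > 0"
    unfolding scale by (simp add: sum_power2_gt_zero_iff)
  define E :: complex where "E = of_real (1 - 2 * l * w3)"
  define N where "N = z - 2 * of_real l * Complex w1 w2"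
  \<comment> \<open>\<open>E\<close> and \<open>N\<close> turn out to be affine in \<open>g\<close>,
    so the harmonic relation between \<open>z\<close> and \<open>N / E\<close> is algebra modulo the
    equation for \<open>g\<close>.\<close>
  define g where "g = (z - p) * (z - q) / (z * (p - q)\<^sup>2)"
  have g: "g * z * (p - q)\<^sup>2 = (z - p) * (z - q)"
    using nz by (simp add: g_def)
  have E: "E = 1 + 2 * (p + q) * g"
  proof -
    have "1 - 2 * (- \<i> * (z - p) * (z - q) / (z * s)) * (- \<i> * (p + q) / s)
        = 1 + 2 * (p + q) * ((z - p) * (z - q) / (z * s\<^sup>2))" if "s \<noteq> 0" for s
      using nz(3) that by (simp add: field_simps power2_eq_square)
    from this[OF nz(4)] show ?thesis
      unfolding E_def of_real_diff of_real_mult l w3 g_def by simp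
  qed
  have N: "N = z + 4 * p * q * g"
    unfolding N_def l w12 g_def using nz by (simp add: field_simps power2_eq_square)
  have "E \<noteq> 0"
    using pos by (simp add: E_def del: of_real_diff of_real_mult)
  have "(z - p) * (N - q * E) + (N - p * E) * (z - q) = 0"
    unfolding E N using g by algebra
  moreover have "N = N / E * E"
    using \<open>E \<noteq> 0\<close> by simp
  ultimately have "((z - p) * (N / E - q) + (N / E - p) * (z - q)) * E = 0"
    by algebra
  then have "(z - p) * (N / E - q) + (N / E - p) * (z - q) = 0"
    using \<open>E \<noteq> 0\<close> by simp
  then have "geodesic_reflection p q z = N / E"
    using assms by (subst geodesic_reflection_eq_iff) auto
  then show "of_real (1 - 2 * l * w3) * geodesic_reflection p q z = z - 2 * of_real l * Complex w1 w2"
    using \<open>E \<noteq> 0\<close> by (simp add: E_def N_def del: of_real_diff of_real_mult)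
qed

text \<open>This form shows the sign: positive on the open arc from \<alpha> to \<gamma>, negative
  on the open complementary arc, zero at the endpoints. The height descent rests on it.\<close>

lemma lorentz_product_circle_exp:
  assumes w12: "Complex w1 w2 = - 2 * \<i> * circle_exp \<alpha> * circle_exp \<gamma> / (circle_exp \<alpha> - circle_exp \<gamma>)"
    and w3: "of_real w3 = - \<i> * (circle_exp \<alpha> + circle_exp \<gamma>) / (circle_exp \<alpha> - circle_exp \<gamma>)"
    and "\<alpha> < \<gamma>" "\<gamma> < \<alpha> + 1"
  shows "Re (circle_exp y) * w1 + Im (circle_exp y) * w2 - w3
    = 2 * sin (pi * (y - \<alpha>)) * sin (pi * (\<gamma> - y)) / sin (pi * (\<gamma> - \<alpha>))" (is "?l = ?r")
proof -
  have sin_pos: "sin (pi * (\<gamma> - \<alpha>)) > 0"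
    using assms by (auto intro!: sin_pi_pos)
  have ne: "circle_exp \<alpha> \<noteq> circle_exp \<gamma>"
    using sin_pos circle_exp_minus_circle_exp[of \<gamma> \<alpha>] by auto
  have "of_real ?l = - \<i> * (circle_exp y - circle_exp \<alpha>) * (circle_exp y - circle_exp \<gamma>) /
      (circle_exp y * (circle_exp \<alpha> - circle_exp \<gamma>))"
    by (rule lorentz_product_normal[OF _ _ _ ne w12 w3]) auto
  also have "\<dots> = - \<i> * (circle_exp y - circle_exp \<alpha>) * (circle_exp \<gamma> - circle_exp y) /
      (circle_exp y * (circle_exp \<gamma> - circle_exp \<alpha>))"
    using ne by (simp add: divide_simps) (simp add: algebra_simps)
  also have "circle_exp y * (circle_exp \<gamma> - circle_exp \<alpha>)
      = 2 * \<i> * of_real (sin (pi * (\<gamma> - \<alpha>))) * circle_exp ((y + \<alpha>) / 2) * circle_exp ((\<gamma> + y) / 2)"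
  proof -
    have "circle_exp y * circle_exp ((\<gamma> + \<alpha>) / 2) = circle_exp ((y + \<alpha>) / 2) * circle_exp ((\<gamma> + y) / 2)"
      unfolding circle_exp_add[symmetric] by (rule arg_cong[of _ _ circle_exp]) (simp add: field_simps)
    then show ?thesis
      unfolding circle_exp_minus_circle_exp by algebra
  qed
  also have "- \<i> * (circle_exp y - circle_exp \<alpha>) * (circle_exp \<gamma> - circle_exp y) / \<dots> = of_real ?r"
    unfolding circle_exp_minus_circle_exp using sin_pos by (simp add: field_simps)
  finally show ?thesis
    by (simp only: of_real_eq_iff)
qed

section \<open>Integral normals and rational points\<close>

lemma circle_point_scaled:
  assumes "pythagorean_triple t"
  shows "of_int (t $ 3) * circle_point t = Complex (of_int (t $ 1)) (of_int (t $ 2))"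
  using assms by (simp add: pythagorean_triple_def circle_point_def complex_eq_iff)

lemma norm_circle_point:
  assumes "pythagorean_triple t"
  shows "cmod (circle_point t) = 1"
proof -
  have "cmod (Complex (of_int (t $ 1)) (of_int (t $ 2))) = sqrt (of_int ((t $ 1)\<^sup>2 + (t $ 2)\<^sup>2))"
    by (simp add: complex_norm)
  also have "\<dots> = of_int (t $ 3)"
    using assms by (simp add: pythagorean_triple_def)
  finally have "of_int (t $ 3) * cmod (circle_point t) = of_int (t $ 3)"
    using assms unfolding circle_point_scaled[OF assms, symmetric]
    by (simp add: norm_mult pythagorean_triple_def)
  then show ?thesis
    using assms by (simp add: pythagorean_triple_def)
qed

lemma real_vec_nth: "real_vec t $ i = of_int (t $ i)"
  by (simp add: real_vec_def)

lemma lorentz_form_real_vec: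
  "lorentz_form (real_vec t') (real_vec t) = of_int (t' $ 1 * t $ 1 + t' $ 2 * t $ 2 - t' $ 3 * t $ 3)"
  by (simp add: lorentz_form_def lorentz_matrix_def real_vec_def inner_vec_def matrix_vector_mult_def sum_3 vector_3)

lemma cross3_real_vec:
  "cross3 (lorentz_matrix *v real_vec t') (lorentz_matrix *v real_vec t) =
    vector [of_int (t' $ 3 * t $ 2 - t' $ 2 * t $ 3), of_int (t' $ 1 * t $ 3 - t' $ 3 * t $ 1),
      of_int (t' $ 1 * t $ 2 - t' $ 2 * t $ 1)]"
  by (simp add: cross3_def lorentz_matrix_def real_vec_def matrix_vector_mult_def sum_3 vector_3)

text \<open>The vector of the unimodularity condition is the unit normal of the geodesic, so
  unimodularity makes the reflection in this side an integral Lorentz transformation.\<close>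

lemma unimodular_arc_normal:
  assumes "pythagorean_triple t" "pythagorean_triple t'" "unimodular_arc t t'"
    and ne: "circle_point t \<noteq> circle_point t'"
  obtains w1 w2 w3 :: int where
    "Complex (of_int w1) (of_int w2)
      = - 2 * \<i> * circle_point t * circle_point t' / (circle_point t - circle_point t')"
    "of_real (of_int w3)
      = - \<i> * (circle_point t + circle_point t') / (circle_point t - circle_point t')"
proof -
  define p q where "p = circle_point t" and "q = circle_point t'"
  define a b :: real where "a = of_int (t $ 3)" and "b = of_int (t' $ 3)"
  have ab: "a > 0" "b > 0"
    using assms by (simp_all add: a_def b_def pythagorean_triple_def)
  have t: "real_of_int (t $ 1) = a * Re p" "real_of_int (t $ 2) = a * Im p"
    and t': "real_of_int (t' $ 1) = b * Re q" "real_of_int (t' $ 2) = b * Im q"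
    using circle_point_scaled[OF assms(1)] circle_point_scaled[OF assms(2)]
    by (simp_all add: complex_eq_iff a_def b_def p_def q_def)
  have on_circle: "cmod p = 1" "cmod q = 1" and nz: "p \<noteq> 0" "q \<noteq> 0" "p - q \<noteq> 0"
    using assms norm_circle_point[of t] norm_circle_point[of t'] by (auto simp: p_def q_def)
  \<comment> \<open>The Lorentz product of \<open>(p, 1)\<close> and \<open>(q, 1)\<close>.
    Conjugation inverts points of the circle, so it equals \<open>(p - q)^2 / (2 * p * q)\<close>
    and is nonzero.\<close>
  define k where "k = Re p * Re q + Im p * Im q - 1"
  have k: "2 * p * q * of_real k = (p - q)\<^sup>2"
  proof -
    have "of_real k = (p * cnj q + q * cnj p) / 2 - 1"
      by (simp add: k_def complex_eq_iff)
    then show ?thesis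
      using nz by (simp add: cnj_eq_inverse_if_norm_1 on_circle field_simps power2_eq_square)
  qed
  then have "k \<noteq> 0"
    using nz by auto
  obtain w where w: "real_vec w = (1 / lorentz_form (real_vec t') (real_vec t)) *\<^sub>R
      cross3 (lorentz_matrix *v real_vec t') (lorentz_matrix *v real_vec t)"
    using assms by (auto simp: unimodular_arc_def)
  have "lorentz_form (real_vec t') (real_vec t) = a * b * k"
    by (simp add: lorentz_form_real_vec t t' k_def algebra_simps flip: a_def b_def)
  then have "of_int (w $ i) = (vector [b * (a * Im p) - b * Im q * a, b * Re q * a - b * (a * Re p),
      b * Re q * (a * Im p) - b * Im q * (a * Re p)] :: real ^ 3) $ i / (a * b * k)" for i
    using arg_cong[OF w, of "\<lambda>v. v $ i"]
    by (simp add: cross3_real_vec t t' real_vec_nth flip: a_def b_def)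
  from this[of 1] this[of 2] this[of 3]
  have "a * b * (of_int (w $ 1) * k) = a * b * (Im p - Im q)"
    "a * b * (of_int (w $ 2) * k) = a * b * (Re q - Re p)"
    "a * b * (of_int (w $ 3) * k) = a * b * (Re q * Im p - Im q * Re p)"
    using ab \<open>k \<noteq> 0\<close> by (simp_all add: vector_3 field_simps)
  then have w_eq: "of_int (w $ 1) * k = Im p - Im q" "of_int (w $ 2) * k = Re q - Re p"
    "of_int (w $ 3) * k = Re q * Im p - Im q * Re p"
    using ab by simp_all
  show thesis
  proof (rule that)
    have "Complex (of_int (w $ 1)) (of_int (w $ 2)) * of_real k = - \<i> * (p - q)"
      using w_eq by (simp add: complex_eq_iff)
    then have "Complex (of_int (w $ 1)) (of_int (w $ 2)) * (p - q) * (p - q) = - 2 * \<i> * p * q * (p - q)"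
      using k by algebra
    then have "Complex (of_int (w $ 1)) (of_int (w $ 2)) * (p - q) = - 2 * \<i> * p * q"
      using nz(3) mult_right_cancel by blast
    then show "Complex (of_int (w $ 1)) (of_int (w $ 2))
      = - 2 * \<i> * circle_point t * circle_point t' / (circle_point t - circle_point t')"
      using nz(3) unfolding p_def q_def by (subst nonzero_eq_divide_eq) simp_all
    have "of_real (of_int (w $ 3)) * of_real k = - \<i> * (p * cnj q - q * cnj p) / 2"
      using w_eq(3) by (simp add: complex_eq_iff field_simps)
    then have "2 * p * q * (of_real (of_int (w $ 3)) * of_real k) = - \<i> * (p\<^sup>2 - q\<^sup>2)"
      using nz by (simp add: cnj_eq_inverse_if_norm_1 on_circle field_simps power2_eq_square)
    then have "of_real (of_int (w $ 3)) * (p - q) * (p - q) = - \<i> * (p + q) * (p - q)"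
      using k by algebra
    then have "of_real (of_int (w $ 3)) * (p - q) = - \<i> * (p + q)"
      using nz(3) mult_right_cancel by blast
    then show "of_real (of_int (w $ 3))
      = - \<i> * (circle_point t + circle_point t') / (circle_point t - circle_point t')"
      using nz(3) unfolding p_def q_def by (subst nonzero_eq_divide_eq) simp_all
  qed
qed

text \<open>For \<open>z\<close> on the circle this says that \<open>(u, v, r)\<close> is an
  integral null vector over \<open>z\<close>. Common factors are allowed, so an integral Lorentz
  reflection acts on such vectors without renormalization.\<close>

definition gaussian_multiple :: "int \<Rightarrow> complex \<Rightarrow> bool" where
  "gaussian_multiple r z \<longleftrightarrow> r > 0 \<and> (\<exists>u v :: int. of_int r * z = Complex (of_int u) (of_int v))"

text \<open>If \<open>x\<close> is the tangent of half the angle, the point has coordinates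
  \<open>(1 - x^2) / (1 + x^2)\<close> and \<open>2 * x / (1 + x^2)\<close>. Rational tangents are
  dense, and \<open>x = c / d\<close> yields the denominator \<open>d^2 + c^2\<close>.\<close>

lemma ex_rational_point_between:
  assumes "u < v"
  shows "\<exists>y r. u < y \<and> y < v \<and> gaussian_multiple r (circle_exp y)"
proof -
  \<comment> \<open>\<open>n\<close> rounds \<open>u\<close> to a nearest integer and so selects a
    branch of the tangent; \<open>c\<close> cuts the interval off at the end of the branch, and the
    points at one and two thirds keep clear of both ends.\<close>
  define n where "n = \<lfloor>u + 1 / 2\<rfloor>"
  define c where "c = min v (of_int n + 1 / 2)"
  define u' v' where "u' = (2 * u + c) / 3" and "v' = (u + 2 * c) / 3"
  have "of_int n - 1 / 2 \<le> u" "u < of_int n + 1 / 2"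
    unfolding n_def by linarith+
  then have ord: "of_int n - 1 / 2 < u'" "u < u'" "u' < v'" "v' < v" "v' < of_int n + 1 / 2"
    using assms by (auto simp: u'_def v'_def c_def min_def)
  have bounds: "- (pi / 2) < pi * (u' - of_int n)" "pi * (u' - of_int n) < pi * (v' - of_int n)"
    "pi * (v' - of_int n) < pi / 2"
    using ord mult_strict_left_mono[of "- (1 / 2)" "u' - of_int n" pi]
      mult_strict_left_mono[of "v' - of_int n" "1 / 2" pi] by simp_all
  then have "tan (pi * (u' - of_int n)) < tan (pi * (v' - of_int n))"
    by (intro tan_monotone) auto
  then obtain x where x: "x \<in> \<rat>" "tan (pi * (u' - of_int n)) < x" "x < tan (pi * (v' - of_int n))"
    using Rats_dense_in_real by blast
  have "arctan (tan (pi * (u' - of_int n))) < arctan x" "arctan x < arctan (tan (pi * (v' - of_int n)))"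
    using x by (simp_all only: arctan_less_iff)
  moreover have "arctan (tan (pi * (u' - of_int n))) = pi * (u' - of_int n)"
    "arctan (tan (pi * (v' - of_int n))) = pi * (v' - of_int n)"
    using bounds by (intro arctan_tan; linarith)+
  ultimately have x_between: "pi * (u' - of_int n) < arctan x" "arctan x < pi * (v' - of_int n)"
    by simp_all
  define y where "y = of_int n + arctan x / pi"
  have "u < y" "y < v"
  proof -
    have "u' - of_int n < arctan x / pi" "arctan x / pi < v' - of_int n"
      using x_between by (simp_all add: pos_less_divide_eq pos_divide_less_eq mult.commute)
    then show "u < y" "y < v"
      using ord by (simp_all add: y_def)
  qed
  obtain c d :: int where cd: "d > 0" "x = of_int c / of_int d"
    using x(1) by (metis Rats_cases')
  have "circle_exp y = circle_exp (arctan x / pi)"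
    using circle_exp_shift[of "arctan x / pi" n] by (simp add: y_def add.commute)
  also have "\<dots> = cis (arctan x) * cis (arctan x)"
    by (simp add: circle_exp_eq_cis cis_mult)
  also have "cis (arctan x) = Complex 1 x / of_real (sqrt (1 + x\<^sup>2))"
    by (simp add: complex_eq_iff cos_arctan sin_arctan)
  also have "Complex 1 x / of_real (sqrt (1 + x\<^sup>2)) * (Complex 1 x / of_real (sqrt (1 + x\<^sup>2)))
      = Complex (1 - x\<^sup>2) (2 * x) / of_real (1 + x\<^sup>2)"
  proof -
    have "(of_real (sqrt (1 + x\<^sup>2)) :: complex) * of_real (sqrt (1 + x\<^sup>2)) = of_real (1 + x\<^sup>2)"
      unfolding of_real_mult[symmetric] by simp
    then show ?thesis
      by (simp add: times_divide_times_eq complex_mult power2_eq_square)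
  qed
  finally have y_eq: "circle_exp y = Complex (1 - x\<^sup>2) (2 * x) / of_real (1 + x\<^sup>2)" .
  have "1 + x\<^sup>2 > 0"
    by (simp add: add_pos_nonneg)
  moreover have "real_of_int (d\<^sup>2 + c\<^sup>2) = (of_int d)\<^sup>2 * (1 + x\<^sup>2)"
    using cd by (simp add: power_divide distrib_left)
  ultimately have "of_int (d\<^sup>2 + c\<^sup>2) * circle_exp y = of_real ((of_int d)\<^sup>2) * Complex (1 - x\<^sup>2) (2 * x)"
    unfolding y_eq of_real_of_int_eq[symmetric, where ?'a = complex]
    by (simp del: of_real_add of_real_power of_real_of_int_eq of_int_add of_int_power)
  also have "\<dots> = Complex (of_int (d\<^sup>2 - c\<^sup>2)) (of_int (2 * c * d))"
    using cd by (simp add: complex_eq_iff field_simps power2_eq_square)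
  finally have "gaussian_multiple (d\<^sup>2 + c\<^sup>2) (circle_exp y)"
    using cd unfolding gaussian_multiple_def by (blast intro: add_pos_nonneg zero_less_power zero_le_power2)
  with \<open>u < y\<close> \<open>y < v\<close> show ?thesis by blast
qed

section \<open>Unimodular partitions\<close>

lemma int_sequence_bracket:
  fixes f :: "int \<Rightarrow> real"
  assumes "i \<le> k" "f i \<le> y" "y < f k"
  shows "\<exists>j. f j \<le> y \<and> y < f (j + 1)"
proof (rule ccontr)
  assume "\<not> ?thesis"
  then have step: "f j \<le> y \<Longrightarrow> f (j + 1) \<le> y" for j
    by (meson not_le)
  have "f k \<le> y"
    using \<open>i \<le> k\<close> by (induction k rule: int_ge_induct) (use assms(2) step in auto)
  with assms show False by simp
qed

lemma int_sequence_strict_mono: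
  fixes f :: "int \<Rightarrow> real"
  assumes "\<And>j. f j < f (j + 1)" "i < j"
  shows "f i < f j"
  using assms(2) by (induction j rule: int_gr_induct) (use assms(1) less_trans in blast)+

section \<open>The partition points and their lifts to the line\<close>

locale circle_partition =
  fixes m :: nat and t :: "nat \<Rightarrow> int ^ 3" and \<theta> :: "nat \<Rightarrow> complex"
  assumes partition: "unimodular_partition m t"
    and theta_eq: "\<theta> i = circle_point (t i)"
begin

lemma m_ge_3: "m \<ge> 3"
  and triple: "i < m \<Longrightarrow> pythagorean_triple (t i)"
  and arc_unimodular: "i < m \<Longrightarrow> unimodular_arc (t i) (t ((i + 1) mod m))"
  and theta_0: "\<theta> 0 = 1"
  using partition by (auto simp: unimodular_partition_def theta_eq)

lemma norm_theta: "i < m \<Longrightarrow> cmod (\<theta> i) = 1"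
  by (simp add: theta_eq norm_circle_point triple)

lemma coord_theta_strict_mono:
  assumes "i < j" "j < m"
  shows "circle_coord (\<theta> i) < circle_coord (\<theta> j)"
proof -
  have "strict_mono_on {..<m} (\<lambda>i. Arg2pi (\<theta> i))"
    using partition unfolding unimodular_partition_def ccw_ordered_def theta_eq[symmetric]
    by (simp add: theta_0)
  then have "Arg2pi (\<theta> i) < Arg2pi (\<theta> j)"
    using assms by (auto simp: monotone_on_def)
  then show ?thesis
    by (simp add: circle_coord_def divide_strict_right_mono)
qed

lemma coord_theta_0: "circle_coord (\<theta> 0) = 0"
proof -
  have "circle_exp 0 = 1" by (simp add: circle_exp_def)
  then show ?thesis
    using circle_coord_circle_exp[of 0] by (simp add: theta_0 del: circle_coord_circle_exp)
qed

text \<open>The angular coordinates of all lifts of the partition points, in increasing order.\<close>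

definition X :: "int \<Rightarrow> real" where
  "X j = circle_coord (\<theta> (nat (j mod int m))) + of_int (j div int m)"

lemma nat_mod_less: "nat (j mod int m) < m"
  using m_ge_3 by (simp add: nat_less_iff)

lemma circle_exp_X: "circle_exp (X j) = \<theta> (nat (j mod int m))"
  using nat_mod_less[of j] by (simp add: X_def circle_exp_circle_coord norm_theta)

lemma circle_exp_X_nat: "a < m \<Longrightarrow> circle_exp (X (int a)) = \<theta> a"
  by (simp add: circle_exp_X)

lemma circle_exp_X_Suc: "circle_exp (X (int a + 1)) = \<theta> ((a + 1) mod m)"
proof -
  have "nat ((int a + 1) mod int m) = (a + 1) mod m"
    by (metis nat_int of_nat_1 of_nat_add zmod_int)
  then show ?thesis by (simp add: circle_exp_X)
qed

lemma X_shift: "X (j + int m * k) = X j + of_int k"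
  using m_ge_3 by (simp add: X_def)

lemma X_0 [simp]: "X 0 = 0"
  by (simp add: X_def coord_theta_0)

lemma X_multiple: "X (int m * k) = of_int k"
  using X_shift[of 0 k] by simp

lemma X_step: "X j < X (j + 1)" "X (j + 1) < X j + 1"
proof -
  define a where "a = nat (j mod int m)"
  define k where "k = j div int m"
  have j: "j = int a + int m * k" and "a < m"
    using m_ge_3 nat_mod_less[of j] by (simp_all add: a_def k_def)
  have Xj: "X j = circle_coord (\<theta> a) + of_int k"
    by (simp add: X_def a_def k_def)
  have bounds: "0 \<le> circle_coord (\<theta> i)" "circle_coord (\<theta> i) < 1" for i
    using circle_coord_bounds[of "\<theta> i"] by auto
  have "X j < X (j + 1) \<and> X (j + 1) < X j + 1"
  proof (cases "a + 1 < m")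
    case True
    then have "X (int (a + 1)) = circle_coord (\<theta> (a + 1))"
      by (simp add: X_def del: of_nat_Suc of_nat_add)
    then have "X (j + 1) = circle_coord (\<theta> (a + 1)) + of_int k"
      using X_shift[of "int (a + 1)" k] by (simp add: j algebra_simps)
    then show ?thesis
      using Xj True coord_theta_strict_mono[of a "a + 1"] bounds(1)[of a] bounds(2)[of "a + 1"] by simp
  next
    case False
    then have "j + 1 = int m * (k + 1)"
      using \<open>a < m\<close> by (simp add: j algebra_simps)
    then have "X (j + 1) = of_int k + 1"
      by (simp only: X_multiple of_int_add of_int_1)
    moreover have "0 < circle_coord (\<theta> a)"
      using False \<open>a < m\<close> m_ge_3 coord_theta_strict_mono[of 0 a] by (simp add: coord_theta_0)
    ultimately show ?thesis
      using Xj bounds(2)[of a] by simp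
  qed
  then show "X j < X (j + 1)" "X (j + 1) < X j + 1" by auto
qed

lemma X_less: "i < j \<Longrightarrow> X i < X j"
  by (rule int_sequence_strict_mono[of X, OF X_step(1)])

lemma X_less_iff: "X i < X j \<longleftrightarrow> i < j"
  using X_less[of i j] X_less[of j i] by (cases i j rule: linorder_cases) auto

lemma X_le_iff: "X i \<le> X j \<longleftrightarrow> i \<le> j"
  using X_less_iff[of j i] by linarith

section \<open>The pieces of the line and the lift \<open>F\<close>\<close>

lemma ex_piece: "\<exists>j. X j \<le> y \<and> y < X (j + 1)"
proof (rule int_sequence_bracket)
  show "int m * \<lfloor>y\<rfloor> \<le> int m * (\<lfloor>y\<rfloor> + 1)" by (intro mult_left_mono) auto
  show "X (int m * \<lfloor>y\<rfloor>) \<le> y" "y < X (int m * (\<lfloor>y\<rfloor> + 1))"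
    unfolding X_multiple by linarith+
qed

lemma piece_unique: "X i \<le> y \<Longrightarrow> y < X (i + 1) \<Longrightarrow> X j \<le> y \<Longrightarrow> y < X (j + 1) \<Longrightarrow> i = j"
  using X_less_iff[of i "j + 1"] X_less_iff[of j "i + 1"] by linarith

text \<open>\<open>s + of_int j\<close> is the point with opposite ratio in
  \<open>(X (j + 1) - 1, X j]\<close>, a lift of the complementary arc; monotonicity of the ratio
  makes it unique.\<close>

definition is_lift_value :: "int \<Rightarrow> real \<Rightarrow> real \<Rightarrow> bool" where
  "is_lift_value j y s \<longleftrightarrow> X j \<le> y \<and> y < X (j + 1) \<and> X (j + 1) - 1 < s + of_int j \<and> s + of_int j \<le> X j \<and>
    chord_ratio (X j) (X (j + 1)) (s + of_int j) = - chord_ratio (X j) (X (j + 1)) y"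

text \<open>The reflection fixing the partition points \<open>j\<close> and \<open>j + 1\<close> is lifted with the shift \<open>- j\<close>,
  which makes consecutive pieces fit together.\<close>

definition F :: "real \<Rightarrow> real" where
  "F y = (SOME s. \<exists>j. is_lift_value j y s)"

lemma is_lift_value_unique:
  assumes "is_lift_value i y s" "is_lift_value j y s'"
  shows "s = s'"
proof -
  have "i = j"
    using assms piece_unique unfolding is_lift_value_def by blast
  show ?thesis
  proof (rule ccontr)
    assume "s \<noteq> s'"
    then have "chord_ratio (X j) (X (j + 1)) (s + of_int j) \<noteq> chord_ratio (X j) (X (j + 1)) (s' + of_int j)"
      using assms chord_ratio_strict_mono[OF X_step, of j "s + of_int j" "s' + of_int j"]
        chord_ratio_strict_mono[OF X_step, of j "s' + of_int j" "s + of_int j"] X_step(1)[of j]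
      unfolding is_lift_value_def \<open>i = j\<close> by (cases s s' rule: linorder_cases) auto
    then show False
      using assms unfolding is_lift_value_def \<open>i = j\<close> by simp
  qed
qed

lemma F_eqI: "is_lift_value j y s \<Longrightarrow> F y = s"
  unfolding F_def by (rule some_equality) (blast intro: is_lift_value_unique)+

lemma F_is_lift_value:
  assumes "X j \<le> y" "y < X (j + 1)"
  shows "is_lift_value j y (F y)"
proof -
  obtain r where "X (j + 1) - 1 < r" "r \<le> X j"
      "chord_ratio (X j) (X (j + 1)) r = - chord_ratio (X j) (X (j + 1)) y"
    using ex_opposite_chord_ratio[OF X_step assms] by blast
  then have "is_lift_value j y (r - of_int j)"
    using assms by (simp add: is_lift_value_def)
  then show ?thesis
    using F_eqI by metis
qed

text \<open>The bounds on \<open>s\<close> for piece \<open>j\<close> read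
  \<open>Y j \<le> - s\<close> and \<open>- s < Y (j + 1)\<close>; as \<open>Y\<close> grows by
  \<open>m - 1\<close> over \<open>m\<close> steps, some \<open>j\<close> satisfies them.\<close>

lemma F_surj: "\<exists>y. F y = s"
proof -
  define Y where "Y j = of_int j - X j" for j :: int
  have "\<exists>j. Y j \<le> - s \<and> - s < Y (j + 1)"
  proof (rule int_sequence_bracket)
    define k where "k = \<lfloor>- s / (real m - 1)\<rfloor>"
    have Y: "Y (int m * i) = of_int i * (real m - 1)" for i
      by (simp only: Y_def X_multiple) (simp add: algebra_simps)
    have pos: "real m - 1 > 0"
      using m_ge_3 by simp
    have "of_int k \<le> - s / (real m - 1)" "- s / (real m - 1) < of_int (k + 1)"
      unfolding k_def by linarith+
    then show "Y (int m * k) \<le> - s" "- s < Y (int m * (k + 1))"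
      unfolding Y pos_le_divide_eq[OF pos] pos_divide_less_eq[OF pos] .
  qed (auto intro: mult_left_mono)
  then obtain j where "Y j \<le> - s" "- s < Y (j + 1)"
    by blast
  then have j: "X (j + 1) - 1 < s + of_int j" "s + of_int j \<le> X j"
    by (simp_all add: Y_def)
  from ex_opposite_chord_ratio'[OF X_step j] obtain y where "is_lift_value j y s"
    using j by (auto simp: is_lift_value_def)
  then show ?thesis
    using F_eqI by blast
qed

lemma F_less:
  assumes "x < y"
  shows "F y < F x"
proof -
  obtain i j where i: "X i \<le> x" "x < X (i + 1)" and j: "X j \<le> y" "y < X (j + 1)"
    using ex_piece by metis
  note Fx = F_is_lift_value[OF i] and Fy = F_is_lift_value[OF j]
  have "i \<le> j"
    using i j assms X_less_iff[of i "j + 1"] by linarith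
  then consider "i = j" | "i + 1 \<le> j" by linarith
  then show ?thesis
  proof cases
    case 1
    show ?thesis
    proof (rule ccontr)
      assume "\<not> F y < F x"
      then have "F x + of_int j \<le> F y + of_int j" by simp
      then have "chord_ratio (X j) (X (j + 1)) (F x + of_int j) \<le> chord_ratio (X j) (X (j + 1)) (F y + of_int j)"
        using Fx Fy 1 X_step(1)[of j] chord_ratio_strict_mono[OF X_step, of j "F x + of_int j" "F y + of_int j"]
        unfolding is_lift_value_def by (cases "F x = F y") auto
      moreover have "chord_ratio (X j) (X (j + 1)) x < chord_ratio (X j) (X (j + 1)) y"
        using i j 1 X_step(2)[of j] by (intro chord_ratio_strict_mono[OF X_step] assms) auto
      ultimately show False
        using Fx Fy 1 unfolding is_lift_value_def by simp
    qed
  next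
    case 2
    define Y where "Y k = of_int k - X k" for k :: int
    \<comment> \<open>Each arc is shorter than a full turn, so \<open>Y\<close> increases and the
      images of later pieces lie lower.\<close>
    have "Y k < Y (k + 1)" for k
      using X_step(2)[of k] by (simp add: Y_def)
    then have "Y (i + 1) \<le> Y j"
      using 2 int_sequence_strict_mono[of Y "i + 1" j] by (cases "i + 1 = j") auto
    then show ?thesis
      using Fx Fy unfolding is_lift_value_def Y_def by auto
  qed
qed

lemma F_X: "F (X j) = X j - of_int j"
  using X_step[of j] by (intro F_eqI[of j]) (simp add: is_lift_value_def)

lemma F_0 [simp]: "F 0 = 0"
  using F_X[of 0] by simp

text \<open>Adding 1 raises the index of the piece by \<open>m\<close>, so the value changes by the
  turn itself minus \<open>m\<close>.\<close>

lemma F_add_one: "F (y + 1) = F y - (real m - 1)"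
proof -
  obtain j where "X j \<le> y" "y < X (j + 1)"
    using ex_piece by blast
  from F_is_lift_value[OF this] have "is_lift_value (j + int m) (y + 1) (F y - (real m - 1))"
    using X_shift[of j 1] X_shift[of "j + 1" 1]
    by (simp add: is_lift_value_def chord_ratio_def algebra_simps)
  then show ?thesis by (rule F_eqI)
qed

text \<open>A monotone function with open range has no jumps; surjectivity thus replaces a
  comparison of one-sided limits at the points \<open>X j\<close>.\<close>

lemma continuous_F: "continuous_on UNIV F"
proof -
  have "continuous_on UNIV (\<lambda>y. - F y)"
  proof (rule continuous_onI_mono)
    have "\<exists>y. z = - F y" for z
      using F_surj[of "- z"] by (metis minus_minus)
    then have "range (\<lambda>y. - F y) = UNIV" by auto
    then show "open (range (\<lambda>y. - F y))" by simp
    show "- F x \<le> - F y" if "x \<le> y" for x y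
      using F_less[of x y] that by (cases "x = y") auto
  qed
  from continuous_on_minus[OF this] show ?thesis by simp
qed

sublocale negative_degree_lift F "real m - 1"
  using m_ge_3 F_less F_add_one continuous_F by unfold_locales auto

section \<open>\<open>B\<close> and its digits in terms of \<open>F\<close>\<close>

lemma circle_exp_F:
  assumes "X j \<le> y" "y < X (j + 1)"
  shows "circle_exp (F y) = geodesic_reflection (circle_exp (X j)) (circle_exp (X (j + 1))) (circle_exp y)"
proof -
  have "circle_exp (F y) = circle_exp (F y + of_int j)" by simp
  also have "\<dots> = geodesic_reflection (circle_exp (X j)) (circle_exp (X (j + 1))) (circle_exp y)"
    using F_is_lift_value[OF assms] X_step[of j]
    by (intro geodesic_reflection_circle_exp[symmetric]) (auto simp: is_lift_value_def)
  finally show ?thesis .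
qed

lemma partition_arc_iff:
  assumes "a < m" "y \<in> {0..<1}"
  shows "circle_exp y \<in> partition_arc m \<theta> a \<longleftrightarrow> X (int a) \<le> y \<and> y < X (int a + 1)"
proof -
  have "circle_exp y \<in> partition_arc m \<theta> a \<longleftrightarrow> frac (y - X (int a)) < X (int a + 1) - X (int a)"
    unfolding partition_arc_def
    by (subst circle_exp_X_nat[OF assms(1), symmetric], subst circle_exp_X_Suc[symmetric])
      (rule ccw_arc_circle_exp_iff[OF X_step])
  also have "\<dots> \<longleftrightarrow> X (int a) \<le> y \<and> y < X (int a + 1)"
  proof -
    have bounds: "0 \<le> X (int a)" "X (int a + 1) \<le> 1"
      using X_le_iff[of 0 "int a"] X_le_iff[of "int a + 1" "int m"] assms X_multiple[of 1] by auto
    show ?thesis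
    proof (cases "X (int a) \<le> y")
      case True
      then have "frac (y - X (int a)) = y - X (int a)"
        using assms bounds by (simp add: frac_eq)
      then show ?thesis using True by simp
    next
      case False
      \<comment> \<open>Here \<open>y\<close> lies before the arc, so the counterclockwise distance
        wraps around; it is at least the length of the arc because
        \<open>X (int a + 1) \<le> 1\<close>.\<close>
      then have "frac (y - X (int a)) = y - X (int a) + 1"
        using assms bounds X_step(1)[of "int a"] by (simp add: frac_unique_iff)
      then show ?thesis using False assms bounds by simp
    qed
  qed
  finally show ?thesis .
qed

lemma ex_piece_nat:
  assumes "y \<in> {0..<1}"
  shows "\<exists>a<m. X (int a) \<le> y \<and> y < X (int a + 1)"
proof -
  obtain j where j: "X j \<le> y" "y < X (j + 1)"
    using ex_piece by blast
  have "0 < j + 1" "j < int m"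
    using j assms X_less_iff[of 0 "j + 1"] X_less_iff[of j "int m"] X_multiple[of 1] by auto
  then show ?thesis
    using j by (intro exI[of _ "nat j"]) auto
qed

lemma B_map_eq_frac_F:
  assumes "y \<in> {0..<1}"
  shows "B_map m \<theta> y = frac (F y)"
proof -
  obtain a where a: "a < m" "X (int a) \<le> y" "y < X (int a + 1)"
    using ex_piece_nat[OF assms] by blast
  have "(THE b. b < m \<and> circle_exp y \<in> partition_arc m \<theta> b) = a"
  proof (rule the_equality)
    fix b
    assume "b < m \<and> circle_exp y \<in> partition_arc m \<theta> b"
    then have "int a = int b"
      using piece_unique[OF a(2,3)] partition_arc_iff[OF _ assms] by blast
    then show "b = a" by simp
  qed (use a partition_arc_iff[OF a(1) assms] in blast)
  then have "B_circle m \<theta> (circle_exp y) = circle_exp (F y)"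
    using circle_exp_F[OF a(2,3)]
    by (simp only: B_circle_def Let_def circle_exp_X_nat[OF a(1)] circle_exp_X_Suc)
  then show ?thesis
    by (simp add: B_map_def)
qed

text \<open>\<open>F y + a\<close> lies in \<open>(X (a + 1) - 1, X a]\<close>, within
  \<open>(- 1, 1)\<close>. Its floor is -1 if the fractional part is at least
  \<open>X (a + 1)\<close>, that is if \<open>a < b\<close>, and 0 otherwise; the shift by
  \<open>a\<close> gives the rest of the digit.\<close>

lemma floor_F:
  assumes a: "X (int a) \<le> y" "y < X (int a + 1)" and y: "y \<in> {0..<1}"
    and b: "X (int b) \<le> frac (F y)" "frac (F y) < X (int b + 1)"
  shows "\<lfloor>F y\<rfloor> = - int (d a b)"
proof -
  define n where "n = \<lfloor>F y\<rfloor> + int a"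
  have F: "F y + of_int (int a) = of_int n + frac (F y)"
    by (simp add: n_def frac_def)
  have range: "X (int a + 1) - 1 < of_int n + frac (F y)" "of_int n + frac (F y) \<le> X (int a)"
    using F_is_lift_value[OF a] unfolding is_lift_value_def F by auto
  have "X (int a) < 1"
    using a y by auto
  have "0 \<le> X (int a)"
    using X_le_iff[of 0 "int a"] by simp
  have frac: "0 \<le> frac (F y)" "frac (F y) < 1"
    by (simp_all add: frac_ge_0 frac_lt_1)
  show ?thesis
  proof (cases "a < b")
    case True
    then have "X (int a + 1) \<le> frac (F y)"
      using b X_le_iff[of "int a + 1" "int b"] by simp
    then have "of_int n < (0 :: real)" "- 2 < (of_int n :: real)"
      using range X_step(1)[of "int a"] frac \<open>0 \<le> X (int a)\<close> by linarith+
    then have "n = - 1" by simp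
    then show ?thesis
      using True by (simp add: d_def n_def)
  next
    case False
    then have "frac (F y) < X (int a + 1)"
      using b X_le_iff[of "int b + 1" "int a + 1"] by simp
    then have "- 1 < (of_int n :: real)" "of_int n < (1 :: real)"
      using range frac \<open>X (int a) < 1\<close> by linarith+
    then have "n = 0" by simp
    then show ?thesis
      using False by (simp add: d_def n_def)
  qed
qed

section \<open>Values of \<open>H\<close> at partition points, and the height descent\<close>

lemma H_0 [simp]: "H 0 = 0"
  using H_functional[of 0] m_ge_3 by (simp add: algebra_simps)

text \<open>As \<open>F (X j) = X j - of_int j\<close>, the functional equation and the shift rule
  force \<open>H (X j) = j / m\<close>; in particular \<open>H\<close> separates the points
  \<open>X j\<close>.\<close>

lemma H_X: "real m * H (X j) = of_int j"
  using H_functional[of "X j"] H_shift[of "X j" "- j"] by (simp add: F_X algebra_simps)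

text \<open>Minus the Lorentz product of the null vector \<open>r * (z, 1)\<close> with the sum of
  all \<open>t b\<close>. At rational points of the circle it is a nonnegative integer, hence a
  measure for descent.\<close>

definition height :: "int \<Rightarrow> complex \<Rightarrow> real" where
  "height r z = (\<Sum>b<m. of_int r * of_int (t b $ 3) * (1 - Re (z * cnj (\<theta> b))))"

lemma height_nonneg:
  assumes "r > 0" "cmod z = 1"
  shows "0 \<le> height r z"
  unfolding height_def
proof (intro sum_nonneg mult_nonneg_nonneg)
  fix b
  assume "b \<in> {..<m}"
  then have "cmod (z * cnj (\<theta> b)) = 1" "0 < t b $ 3"
    using assms norm_theta[of b] triple[of b] by (auto simp: norm_mult pythagorean_triple_def)
  then show "0 \<le> 1 - Re (z * cnj (\<theta> b))" "0 \<le> real_of_int (t b $ 3)" "0 \<le> real_of_int r"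
    using complex_Re_le_cmod[of "z * cnj (\<theta> b)"] assms by simp_all
qed

lemma height_integer:
  assumes "gaussian_multiple r z"
  shows "height r z \<in> \<int>"
  unfolding height_def
proof (intro Ints_sum)
  fix b
  assume "b \<in> {..<m}"
  obtain u v :: int where "of_int r * z = Complex (of_int u) (of_int v)"
    using assms by (auto simp: gaussian_multiple_def)
  then have uv: "of_int r * Re z = of_int u" "of_int r * Im z = of_int v"
    by (auto simp: complex_eq_iff)
  have "of_int (t b $ 3) * \<theta> b = Complex (of_int (t b $ 1)) (of_int (t b $ 2))"
    using \<open>b \<in> {..<m}\<close> by (simp add: theta_eq circle_point_scaled triple)
  then have tb: "of_int (t b $ 3) * Re (\<theta> b) = of_int (t b $ 1)" "of_int (t b $ 3) * Im (\<theta> b) = of_int (t b $ 2)"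
    by (auto simp: complex_eq_iff)
  have "of_int r * of_int (t b $ 3) * (1 - Re (z * cnj (\<theta> b)))
      = of_int r * of_int (t b $ 3) - ((of_int r * Re z) * (of_int (t b $ 3) * Re (\<theta> b))
        + (of_int r * Im z) * (of_int (t b $ 3) * Im (\<theta> b)))"
    by (simp add: algebra_simps)
  also have "\<dots> = of_int (r * t b $ 3 - (u * t b $ 1 + v * t b $ 2))"
    unfolding uv tb by simp
  finally show "of_int r * of_int (t b $ 3) * (1 - Re (z * cnj (\<theta> b))) \<in> \<int>"
    by (metis Ints_of_int)
qed

text \<open>Seen from the side \<open>[X j, X (j + 1)]\<close>, all partition points lie on the other side of the
  geodesic or on it, so the reflection in it lowers the height of the points on the near side.\<close>

lemma height_descent:
  assumes gauss: "gaussian_multiple r (circle_exp y)" and y: "X j < y" "y < X (j + 1)"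
  shows "\<exists>r'. gaussian_multiple r' (circle_exp (F y)) \<and> height r' (circle_exp (F y)) < height r (circle_exp y)"
proof -
  define a where "a = nat (j mod int m)"
  have "a < m"
    by (simp add: a_def nat_mod_less)
  have "nat ((j + 1) mod int m) = (a + 1) mod m"
  proof -
    have "int ((a + 1) mod m) = (int a + 1) mod int m"
      by (simp add: zmod_int add.commute)
    also have "\<dots> = (j + 1) mod int m"
      using m_ge_3 by (simp add: a_def mod_add_left_eq)
    finally show ?thesis by linarith
  qed
  then have pq: "circle_exp (X j) = \<theta> a" "circle_exp (X (j + 1)) = \<theta> ((a + 1) mod m)"
    by (simp_all add: circle_exp_X a_def)
  have ne: "circle_exp (X j) \<noteq> circle_exp (X (j + 1))"
    using X_step[of j] circle_exp_minus_circle_exp[of "X (j + 1)" "X j"] sin_pi_pos[of "X (j + 1) - X j"] by auto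
  obtain w1 w2 w3 :: int where
    w12: "Complex (of_int w1) (of_int w2)
      = - 2 * \<i> * circle_exp (X j) * circle_exp (X (j + 1)) / (circle_exp (X j) - circle_exp (X (j + 1)))" and
    w3: "of_real (of_int w3)
      = - \<i> * (circle_exp (X j) + circle_exp (X (j + 1))) / (circle_exp (X j) - circle_exp (X (j + 1)))"
  proof (rule unimodular_arc_normal)
    have "(a + 1) mod m < m"
      using m_ge_3 by simp
    then show "pythagorean_triple (t a)" "pythagorean_triple (t ((a + 1) mod m))"
      "unimodular_arc (t a) (t ((a + 1) mod m))"
      using \<open>a < m\<close> triple arc_unimodular by auto
    show "circle_point (t a) \<noteq> circle_point (t ((a + 1) mod m))"
      using ne unfolding pq theta_eq .
  qed (unfold pq theta_eq)
  define z where "z = circle_exp y"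
  define l where "l = Re z * of_int w1 + Im z * of_int w2 - of_int w3"
  define z' where "z' = circle_exp (F y)"
  have z': "z' = geodesic_reflection (circle_exp (X j)) (circle_exp (X (j + 1))) z"
    unfolding z'_def z_def using y by (intro circle_exp_F) auto
  have scale: "of_real (1 - 2 * l * of_int w3) * z' = z - 2 * of_real l * Complex (of_int w1) (of_int w2)"
    and scale_pos: "1 - 2 * l * of_int w3 > 0"
    unfolding z' l_def
    by (rule lorentz_reflection[OF _ _ _ ne w12 w3] lorentz_reflection_scale_pos[OF _ _ _ ne w12 w3];
        simp add: z_def)+
  have "l = 2 * sin (pi * (y - X j)) * sin (pi * (X (j + 1) - y)) / sin (pi * (X (j + 1) - X j))"
    unfolding l_def z_def by (rule lorentz_product_circle_exp[OF w12 w3 X_step])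
  then have "l > 0"
    using y X_step[of j] by (auto intro!: divide_pos_pos mult_pos_pos sin_pi_pos)
  obtain u v :: int where "r > 0" and uv: "of_int r * z = Complex (of_int u) (of_int v)"
    using gauss by (auto simp: gaussian_multiple_def z_def)
  then have Re_Im: "of_int r * Re z = of_int u" "of_int r * Im z = of_int v"
    by (auto simp: complex_eq_iff)
  \<comment> \<open>The product of the integral vector \<open>(u, v, r)\<close> with the normal;
    \<open>r'\<close> is then the third coordinate of the reflected vector.\<close>
  define k where "k = u * w1 + v * w2 - r * w3"
  define r' where "r' = r - 2 * k * w3"
  have k: "of_int r * l = of_int k"
    by (simp add: l_def k_def algebra_simps flip: Re_Im)
  have r': "of_int r' = of_int r * (1 - 2 * l * of_int w3)"
    by (simp add: r'_def algebra_simps flip: k)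
  have "r' > 0"
    using scale_pos \<open>r > 0\<close> r' by (metis mult_pos_pos of_int_0_less_iff)
  have r'z': "of_int r' * z' = of_int r * (z - 2 * of_real l * Complex (of_int w1) (of_int w2))"
  proof -
    have "complex_of_int r' = of_int r * of_real (1 - 2 * l * of_int w3)"
      using arg_cong[OF r', of complex_of_real] by (simp only: of_real_mult of_real_of_int_eq)
    then show ?thesis
      unfolding scale[symmetric] by (simp only: mult.assoc)
  qed
  also have "\<dots> = Complex (of_int (u - 2 * k * w1)) (of_int (v - 2 * k * w2))"
    by (simp add: complex_eq_iff algebra_simps flip: Re_Im k)
  finally have "gaussian_multiple r' z'"
    using \<open>r' > 0\<close> unfolding gaussian_multiple_def by blast
  \<comment> \<open>The product of a vertex with the normal; by \<open>height_diff\<close> its sign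
    decides how vertex \<open>b\<close> contributes to the change of height.\<close>
  define \<mu> where "\<mu> b = Re (\<theta> b) * of_int w1 + Im (\<theta> b) * of_int w2 - of_int w3" for b
  have height_diff: "of_int r' * of_int (t b $ 3) * (1 - Re (z' * cnj (\<theta> b)))
      = of_int r * of_int (t b $ 3) * (1 - Re (z * cnj (\<theta> b))) + 2 * of_int r * l * of_int (t b $ 3) * \<mu> b" for b
  proof -
    have "of_int r' * Re (z' * cnj (\<theta> b)) = Re (of_int r' * z' * cnj (\<theta> b))"
      by (simp add: algebra_simps)
    also have "\<dots> = of_int r * (Re (z * cnj (\<theta> b)) - 2 * l * (\<mu> b + of_int w3))"
      unfolding r'z' by (simp add: \<mu>_def algebra_simps)
    finally have "of_int r' * Re (z' * cnj (\<theta> b)) = of_int r * (Re (z * cnj (\<theta> b)) - 2 * l * (\<mu> b + of_int w3))" .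
    then show ?thesis
      using r' by (simp only: right_diff_distrib mult_1_right) algebra
  qed
  have \<mu>: "\<mu> (nat (i mod int m)) = 2 * sin (pi * (X i - X j)) * sin (pi * (X (j + 1) - X i)) / sin (pi * (X (j + 1) - X j))" for i
    unfolding \<mu>_def circle_exp_X[symmetric] by (rule lorentz_product_circle_exp[OF w12 w3 X_step])
  have sin_flip: "sin (pi * (X (j + 1) - X i)) = - sin (pi * (X i - X (j + 1)))" for i
    by (metis minus_diff_eq mult_minus_right sin_minus)
  have "X (j + int m) = X j + 1"
    using X_shift[of j 1] by simp
  have \<mu>_nonpos: "\<mu> b \<le> 0" if "b < m" for b
  proof -
    \<comment> \<open>The index congruent to \<open>b\<close> in the window from
      \<open>j + 1\<close> to \<open>j + m\<close>, whose points lie on the closed complementary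
      arc.\<close>
    define i where "i = j + 1 + (int b - (j + 1)) mod int m"
    have "i mod int m = int b"
      using that by (simp add: i_def mod_add_right_eq)
    have "0 \<le> (int b - (j + 1)) mod int m" "(int b - (j + 1)) mod int m < int m"
      using m_ge_3 by simp_all
    then have "j + 1 \<le> i" "i \<le> j + int m"
      by (auto simp: i_def)
    then have "X (j + 1) \<le> X i" "X i \<le> X j + 1"
      using \<open>X (j + int m) = X j + 1\<close> X_le_iff by metis+
    then have "0 \<le> sin (pi * (X i - X j))" "0 \<le> sin (pi * (X i - X (j + 1)))" "0 < sin (pi * (X (j + 1) - X j))"
      using X_step[of j] by (auto intro!: sin_pi_nonneg sin_pi_pos)
    moreover have "\<mu> b = - (2 * sin (pi * (X i - X j)) * sin (pi * (X i - X (j + 1)))) / sin (pi * (X (j + 1) - X j))"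
      using \<mu>[of i] \<open>i mod int m = int b\<close> by (simp only: sin_flip[of i] nat_int mult_minus_right)
    ultimately show ?thesis
      by (simp only: divide_nonpos_pos neg_le_0_iff_le mult_nonneg_nonneg zero_le_numeral)
  qed
  \<comment> \<open>The endpoints of the side contribute 0. Since \<open>m \<ge> 3\<close>, the
    vertex after \<open>j + 1\<close> lies strictly beyond the side and makes the descent
    strict.\<close>
  have \<mu>_neg: "\<exists>b<m. \<mu> b < 0"
  proof (intro exI conjI)
    show "nat ((j + 2) mod int m) < m"
      by (rule nat_mod_less)
    have "X (j + 1) < X (j + 2)" "X (j + 2) < X j + 1"
      using X_less[of "j + 1" "j + 2"] X_less[of "j + 2" "j + int m"] m_ge_3 \<open>X (j + int m) = X j + 1\<close> by auto
    then have "0 < sin (pi * (X (j + 2) - X j))" "0 < sin (pi * (X (j + 2) - X (j + 1)))" "0 < sin (pi * (X (j + 1) - X j))"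
      using X_step[of j] by (auto intro!: sin_pi_pos)
    then show "\<mu> (nat ((j + 2) mod int m)) < 0"
      unfolding \<mu> sin_flip[of "j + 2"] mult_minus_right
      by (intro divide_neg_pos) simp_all
  qed
  have t_pos: "0 < real_of_int (t b $ 3)" if "b < m" for b
    using triple[OF that] by (simp add: pythagorean_triple_def)
  have "height r' z' < height r z"
    unfolding height_def
  proof (rule sum_strict_mono_ex1)
    have pos: "0 < 2 * of_int r * l * of_int (t b $ 3)" if "b < m" for b
      using \<open>r > 0\<close> \<open>l > 0\<close> t_pos[OF that] by simp
    show "\<forall>b\<in>{..<m}. of_int r' * of_int (t b $ 3) * (1 - Re (z' * cnj (\<theta> b)))
        \<le> of_int r * of_int (t b $ 3) * (1 - Re (z * cnj (\<theta> b)))"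
      unfolding height_diff using mult_nonneg_nonpos[OF less_imp_le[OF pos] \<mu>_nonpos] by simp
    obtain b where "b < m" "\<mu> b < 0"
      using \<mu>_neg by blast
    then show "\<exists>b\<in>{..<m}. of_int r' * of_int (t b $ 3) * (1 - Re (z' * cnj (\<theta> b)))
        < of_int r * of_int (t b $ 3) * (1 - Re (z * cnj (\<theta> b)))"
      unfolding height_diff using mult_pos_neg[OF pos, of b "\<mu> b"] by (intro bexI[of _ b]) simp_all
  qed simp
  with \<open>gaussian_multiple r' z'\<close> show ?thesis
    unfolding z_def z'_def by blast
qed

text \<open>Heights are nonnegative integers and drop at every step that starts off the partition
  points, so the orbit must hit one.\<close>

lemma rational_point_reaches_vertex:
  assumes "gaussian_multiple r (circle_exp y)"
  shows "\<exists>n. (F ^^ n) y \<in> range X"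
  using assms
proof (induction "nat \<lfloor>height r (circle_exp y)\<rfloor>" arbitrary: r y rule: less_induct)
  case less
  show ?case
  proof (cases "y \<in> range X")
    case True
    then show ?thesis by (intro exI[of _ 0]) simp
  next
    case False
    obtain j where j: "X j \<le> y" "y < X (j + 1)"
      using ex_piece by blast
    moreover have "X j \<noteq> y"
      using False by blast
    ultimately have "X j < y" "y < X (j + 1)"
      by simp_all
    from height_descent[OF less.prems this] obtain r' where r':
      "gaussian_multiple r' (circle_exp (F y))" "height r' (circle_exp (F y)) < height r (circle_exp y)"
      by blast
    have "0 \<le> height r' (circle_exp (F y))"
      using r'(1) by (intro height_nonneg) (auto simp: gaussian_multiple_def)
    moreover obtain h h' where "height r (circle_exp y) = of_int h" "height r' (circle_exp (F y)) = of_int h'"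
      using height_integer[OF r'(1)] height_integer[OF less.prems] by (meson Ints_cases)
    ultimately have "nat \<lfloor>height r' (circle_exp (F y))\<rfloor> < nat \<lfloor>height r (circle_exp y)\<rfloor>"
      using r'(2) by simp
    from less.hyps[OF this r'(1)] obtain n where "(F ^^ n) (F y) \<in> range X" by blast
    then have "(F ^^ Suc n) y \<in> range X"
      by (simp only: funpow_Suc_right comp_apply)
    then show ?thesis ..
  qed
qed

section \<open>Strict monotonicity of \<open>H\<close>\<close>

lemma vertex_iterate: "y \<in> range X \<Longrightarrow> (F ^^ n) y \<in> range X"
proof (induction n)
  case (Suc n)
  then obtain j where "(F ^^ n) y = X j" by auto
  then have "(F ^^ Suc n) y = X (j + int m * (- j))"
    by (simp only: funpow.simps comp_apply F_X X_shift of_int_minus diff_conv_add_uminus)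
  then show ?case by (metis rangeI)
qed simp

lemma H_less:
  assumes "u < v"
  shows "H u < H v"
proof (rule ccontr)
  assume "\<not> H u < H v"
  then have const: "H y = H u" if "u \<le> y" "y \<le> v" for y
    using H_mono[OF that(1)] H_mono[OF that(2)] by linarith
  \<comment> \<open>Splitting at \<open>c\<close> makes the two rational points distinct.\<close>
  obtain c where c: "u < c" "c < v"
    using dense[OF assms] by blast
  obtain x r where x: "u < x" "x < c" "gaussian_multiple r (circle_exp x)"
    using ex_rational_point_between[OF c(1)] by blast
  obtain y s where y: "c < y" "y < v" "gaussian_multiple s (circle_exp y)"
    using ex_rational_point_between[OF c(2)] by blast
  obtain n k where n: "(F ^^ n) x \<in> range X" and k: "(F ^^ k) y \<in> range X"
    using rational_point_reaches_vertex x(3) y(3) by blast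
  \<comment> \<open>Partition points stay partition points, so \<open>k + n\<close> steps serve both
    orbits; equal values of \<open>H\<close> then force equal vertices by
    \<open>H_X\<close>.\<close>
  have "(F ^^ (k + n)) x \<in> range X"
    using vertex_iterate[OF n, of k] by (simp only: funpow_add comp_apply)
  moreover have "(F ^^ (k + n)) y \<in> range X"
    using vertex_iterate[OF k, of n] by (simp only: add.commute[of k n] funpow_add comp_apply)
  ultimately obtain i j where ij: "(F ^^ (k + n)) x = X i" "(F ^^ (k + n)) y = X j"
    by blast
  have "H x = H y"
    using const[of x] const[of y] x y c by simp
  then have "H (X i) = H (X j)"
    unfolding ij[symmetric] H_functional_iterate by (rule arg_cong)
  then have "i = j"
    by (metis H_X of_int_eq_iff)
  then have "(F ^^ (k + n)) x = (F ^^ (k + n)) y"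
    by (simp only: ij)
  then have "x = y"
    by (rule injD[OF inj_iterate])
  then show False
    using x(2) y(1) by linarith
qed

section \<open>Existence and uniqueness of the conjugacy\<close>

lemma H_shift_one: "H (x + 1) = H x + 1"
  using H_shift[of x 1] by simp

lemma H_1: "H 1 = 1"
  using H_shift_one[of 0] by (simp only: H_0 add_0)

lemma H_range:
  assumes "x \<in> {0..<1}"
  shows "H x \<in> {0..<1}"
  using assms H_mono[of 0 x] H_less[of x 1] by (simp add: H_1)

text \<open>\<open>H\<close> commutes with integer translations, so its value at
  \<open>frac (F x)\<close> differs from \<open>- (real m - 1) * H x\<close> by an integer; lying in
  \<open>[0, 1)\<close>, it is the fractional part.\<close>

lemma H_conjugacy:
  assumes "x \<in> {0..<1}"
  shows "H (B_map m \<theta> x) = T_map m (H x)"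
proof -
  have "H (frac (F x)) = - (real m - 1) * H x - of_int \<lfloor>F x\<rfloor>"
    using H_shift[of "F x" "- \<lfloor>F x\<rfloor>"] by (simp add: frac_def H_functional)
  moreover have "H (frac (F x)) \<in> {0..<1}"
    by (intro H_range) (simp add: frac_ge_0 frac_lt_1)
  ultimately show ?thesis
    unfolding B_map_eq_frac_F[OF assms] T_map_def by (intro frac_unique_iff[THEN iffD2, symmetric]) auto
qed

lemma H_surj: "\<exists>x. H x = y"
proof -
  have "\<exists>x\<ge>0. x \<le> 1 \<and> H x = frac y"
    using H_shift_one[of 0] frac_lt_1[of y]
    by (intro IVT' continuous_on_subset[OF H_continuous]) (auto simp: frac_ge_0)
  then obtain x where "H x = frac y" by blast
  then have "H (x + of_int \<lfloor>y\<rfloor>) = y"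
    by (simp add: H_shift frac_def)
  then show ?thesis ..
qed

lemma is_conjugacy_H: "is_conjugacy m \<theta> (restrict H {0..<1})"
proof -
  have "inj H"
    by (rule injI) (metis H_less less_irrefl linorder_neqE_linordered_idom)
  define g where "g = inv H"
  have gH: "g (H x) = x" for x
    unfolding g_def by (rule inv_f_f[OF \<open>inj H\<close>])
  have Hg: "H (g x) = x" for x
    using H_surj[of x] gH by metis
  have g_mono: "g x \<le> g y" if "x \<le> y" for x y
    using that H_less[of "g y" "g x"] unfolding Hg by linarith
  have "continuous_on UNIV g"
  proof (rule continuous_onI_mono)
    have "range g = UNIV"
      by (rule surjI) (rule gH)
    then show "open (range g)" by simp
  qed (rule g_mono)
  have g_range: "g x \<in> {0..<1}" if "x \<in> {0..<1}" for x
  proof -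
    have "g 0 = 0" "g 1 = 1"
      using gH[of 0] gH[of 1] by (simp_all only: H_0 H_1)
    moreover have "g x \<noteq> 1"
      using Hg[of x] that by (auto simp: H_1)
    ultimately show ?thesis
      using that g_mono[of 0 x] g_mono[of x 1] by simp
  qed
  have cont: "continuous_on {0..<1} (restrict H {0..<1})"
    using continuous_on_subset[OF H_continuous]
    by (rule continuous_on_eq[where f = H]) simp_all
  have "homeomorphic_maps (top_of_set {0..<1}) (top_of_set {0..<1}) (restrict H {0..<1}) g"
    unfolding homeomorphic_maps_def continuous_map_subtopology_eu topspace_euclidean_subtopology
  proof (intro conjI ballI)
    show "continuous_on {0..<1} g"
      by (rule continuous_on_subset[OF \<open>continuous_on UNIV g\<close>]) simp
    show "g (restrict H {0..<1} x) = x" if "x \<in> {0..<1}" for x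
      unfolding restrict_apply'[OF that] by (rule gH)
    show "restrict H {0..<1} (g x) = x" if "x \<in> {0..<1}" for x
      unfolding restrict_apply'[OF g_range[OF that]] by (rule Hg)
    show "restrict H {0..<1} \<in> {0..<1} \<rightarrow> {0..<1}"
      using H_range by (intro funcsetI) (simp only: restrict_apply')
    show "g \<in> {0..<1} \<rightarrow> {0..<1}"
      using g_range by (rule funcsetI)
  qed (rule cont)
  then have "homeomorphic_map (top_of_set {0..<1}) (top_of_set {0..<1}) (restrict H {0..<1})"
    using homeomorphic_map_maps by blast
  moreover have "restrict H {0..<1} (B_map m \<theta> x) = T_map m (restrict H {0..<1} x)" if "x \<in> {0..<1}" for x
  proof -
    have "B_map m \<theta> x \<in> {0..<1}"
      unfolding B_map_def by (rule circle_coord_bounds)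
    then show ?thesis
      using that H_conjugacy by (simp only: restrict_apply')
  qed
  ultimately show ?thesis
    unfolding is_conjugacy_def by blast
qed

text \<open>A conjugacy is increasing and fixes 0, so it extends to a lift \<open>G\<close>
  commuting with the unit translation. \<open>G\<close> satisfies the functional equation and stays
  within 1 of the identity, which is what \<open>H_unique\<close> asks for.\<close>

lemma conjugacy_eq_H:
  assumes "is_conjugacy m \<theta> f" "x \<in> {0..<1}"
  shows "f x = H x"
proof -
  define S :: "real set" where "S = {0..<1}"
  have homeo: "homeomorphic_map (top_of_set S) (top_of_set S) f"
    and conj: "\<And>y. y \<in> S \<Longrightarrow> f (B_map m \<theta> y) = T_map m (f y)"
    using assms(1) by (auto simp: is_conjugacy_def S_def)
  have "continuous_on S f"
    using homeomorphic_imp_continuous_map[OF homeo] by simp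
  have image: "f ` S = S"
    using homeomorphic_imp_surjective_map[OF homeo] by simp
  have "inj_on f S"
    using homeomorphic_imp_injective_map[OF homeo] by simp
  moreover have "is_interval S"
    by (simp add: S_def)
  ultimately have monotone: "strict_mono_on S f \<or> strict_antimono_on S f"
    using injective_eq_monotone_map[OF _ \<open>continuous_on S f\<close>] by blast
  have "0 \<in> S"
    by (simp add: S_def)
  \<comment> \<open>\<open>[0, 1)\<close> has no greatest element, but a decreasing surjection would
    make \<open>f 0\<close> the greatest value.\<close>
  have "\<not> strict_antimono_on S f"
  proof
    assume anti: "strict_antimono_on S f"
    have "f 0 \<in> S" using image \<open>0 \<in> S\<close> by blast
    then have "(f 0 + 1) / 2 \<in> S" "f 0 < (f 0 + 1) / 2"
      by (simp_all add: S_def)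
    then obtain y where y: "y \<in> S" "f 0 < f y"
      using image by (metis imageE)
    then have "0 < y"
      by (cases "y = 0") (auto simp: S_def)
    then have "f y < f 0"
      using anti \<open>0 \<in> S\<close> y(1) by (simp add: monotone_on_def)
    with y show False by simp
  qed
  then have f_less: "f y < f z" if "y \<in> S" "z \<in> S" "y < z" for y z
    using monotone that by (auto simp: monotone_on_def)
  have f_range: "0 \<le> f y" "f y < 1" if "y \<in> S" for y
    using image that by (auto simp: S_def)
  have "f 0 = 0"
  proof -
    obtain y where y: "y \<in> S" "f y = 0"
      using image \<open>0 \<in> S\<close> by (metis imageE)
    then show ?thesis
      using f_less[OF \<open>0 \<in> S\<close> y(1)] f_range[OF \<open>0 \<in> S\<close>] by (cases "y = 0") (auto simp: S_def)
  qed
  define G where "G y = f (frac y) + of_int \<lfloor>y\<rfloor>" for y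
  have frac_S: "frac y \<in> S" for y
    by (simp add: S_def frac_ge_0 frac_lt_1)
  have G_less: "G y < G z" if "y < z" for y z
  proof (cases "\<lfloor>y\<rfloor> = \<lfloor>z\<rfloor>")
    case True
    then have "frac y < frac z"
      using that by (simp add: frac_def)
    then show ?thesis
      using f_less[OF frac_S frac_S, of y z] True by (simp add: G_def)
  next
    case False
    have "\<lfloor>y\<rfloor> \<le> \<lfloor>z\<rfloor>"
      using that by (intro floor_mono) simp
    with False have "\<lfloor>y\<rfloor> + 1 \<le> \<lfloor>z\<rfloor>" by simp
    then have "real_of_int \<lfloor>y\<rfloor> + 1 \<le> of_int \<lfloor>z\<rfloor>" by linarith
    then show ?thesis
      using f_range(2)[OF frac_S, of y] f_range(1)[OF frac_S, of z] unfolding G_def by linarith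
  qed
  have "\<exists>y. G y = z" for z
  proof -
    obtain y where y: "y \<in> S" "f y = frac z"
      using image frac_S[of z] by (metis imageE)
    have "\<lfloor>y + of_int \<lfloor>z\<rfloor>\<rfloor> = \<lfloor>z\<rfloor>" "frac (y + of_int \<lfloor>z\<rfloor>) = y"
      using y(1) by (simp_all add: S_def frac_def floor_eq_iff)
    then have "G (y + of_int \<lfloor>z\<rfloor>) = z"
      unfolding G_def by (simp only: y(2)) (simp add: frac_def)
    then show ?thesis ..
  qed
  then have "range G = UNIV"
    by (metis surjI surj_def)
  \<comment> \<open>Being monotone and onto, \<open>G\<close> is continuous also at the integers,
    where its pieces meet.\<close>
  have G_continuous: "continuous_on UNIV G"
  proof (rule continuous_onI_mono)
    show "open (range G)"
      by (simp add: \<open>range G = UNIV\<close>)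
    show "G y \<le> G z" if "y \<le> z" for y z
      using G_less[of y z] that by (cases "y = z") auto
  qed
  \<comment> \<open>The conjugacy yields the functional equation for \<open>G\<close> only modulo
    integers. The error \<delta> is continuous and integer-valued, hence constant, and it vanishes
    at 0.\<close>
  define \<delta> where "\<delta> y = G (F y) + (real m - 1) * G y" for y
  have \<delta>_integer: "\<delta> y \<in> \<int>" for y
  proof -
    have m1: "real m - 1 = of_int (int m - 1)" by simp
    have "F y = F (frac y) - of_int ((int m - 1) * \<lfloor>y\<rfloor>)"
      using F_shift[of "frac y" "\<lfloor>y\<rfloor>"] by (simp add: frac_def)
    then have "frac (F y) = frac (F (frac y))"
      by (simp only: frac_def floor_diff_of_int of_int_diff)
    then have "f (frac (F y)) = T_map m (f (frac y))"
      using conj[OF frac_S, of y] B_map_eq_frac_F[of "frac y"] frac_S[of y] by (simp add: S_def)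
    also have "\<dots> = - (real m - 1) * f (frac y) - of_int \<lfloor>- (real m - 1) * f (frac y)\<rfloor>"
      by (simp only: T_map_def frac_def)
    finally have "\<delta> y = of_int (\<lfloor>F y\<rfloor> - \<lfloor>- (real m - 1) * f (frac y)\<rfloor> + (int m - 1) * \<lfloor>y\<rfloor>)"
      by (simp add: \<delta>_def G_def algebra_simps)
    then show ?thesis by (metis Ints_of_int)
  qed
  have "\<delta> constant_on UNIV"
  proof (rule continuous_discrete_range_constant)
    show "continuous_on UNIV \<delta>"
      unfolding \<delta>_def
      by (intro continuous_intros G_continuous continuous_on_compose2[OF G_continuous F_continuous]) auto
    show "\<exists>e>0. \<forall>z. z \<in> UNIV \<and> \<delta> z \<noteq> \<delta> y \<longrightarrow> e \<le> norm (\<delta> z - \<delta> y)" for y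
    proof (intro exI[of _ 1] conjI allI impI)
      fix z
      assume "z \<in> UNIV \<and> \<delta> z \<noteq> \<delta> y"
      then show "1 \<le> norm (\<delta> z - \<delta> y)"
        using Ints_nonzero_abs_ge1[of "\<delta> z - \<delta> y"] \<delta>_integer by auto
    qed simp
  qed simp
  then have "\<delta> y = \<delta> 0" for y
    unfolding constant_on_def by (metis UNIV_I)
  then have "\<delta> y = 0" for y
    by (simp add: \<delta>_def G_def \<open>f 0 = 0\<close>)
  then have functional: "G (F y) = - (real m - 1) * G y" for y
    unfolding \<delta>_def by (metis add_eq_0_iff2 mult_minus_left)
  have "\<bar>G y - y\<bar> \<le> 1" for y
  proof -
    have "y = frac y + of_int \<lfloor>y\<rfloor>"
      by (simp add: frac_def)
    then show ?thesis
      using f_range[OF frac_S, of y] frac_lt_1[of y] frac_ge_0[of y]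
      unfolding G_def by linarith
  qed
  from H_unique[OF functional this] have "G x = H x" .
  moreover have "G x = f x"
    using assms(2) by (simp add: G_def frac_eq floor_eq_iff)
  ultimately show ?thesis by simp
qed

section \<open>Identification of \<open>Phi\<close> and the digit series\<close>

lemma Phi_eq_H:
  assumes "x \<in> {0..<1}"
  shows "Phi m \<theta> x = H x"
proof -
  have "f = restrict H {0..<1}" if "is_conjugacy m \<theta> f" for f
    using that by (intro extensionalityI[of f "{0..<1}"])
      (auto simp: is_conjugacy_def conjugacy_eq_H[OF that])
  then have "Phi m \<theta> = restrict H {0..<1}"
    unfolding Phi_def using is_conjugacy_H by (intro the_equality)
  then show ?thesis
    using assms by simp
qed

text \<open>Each digit is \<open>K * H (y n) + H (y (Suc n))\<close> along the orbit
  \<open>y\<close>, so the weighted partial sums telescope; the remainder tends to 0 because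
  \<open>H\<close> stays in \<open>[0, 1)\<close> on the orbit.\<close>

lemma H_series:
  assumes "x \<in> {0..<1}" and a: "B_symbolic_sequence m \<theta> x a"
  shows "(\<lambda>n. real (d (a n) (a (n + 1))) * (- (1 / (real m - 1))) ^ n) sums ((real m - 1) * H x)"
proof -
  define K where "K = real m - 1"
  have "K > 1"
    using m_ge_3 by (simp add: K_def)
  define y where "y n = (B_map m \<theta> ^^ n) x" for n
  have y_range: "y n \<in> {0..<1}" for n
    using assms(1) circle_coord_bounds by (cases n) (auto simp: y_def B_map_def)
  have y_Suc: "y (Suc n) = frac (F (y n))" for n
    using B_map_eq_frac_F[OF y_range[of n]] by (simp add: y_def)
  have y_piece: "X (int (a n)) \<le> y n" "y n < X (int (a n) + 1)" for n
    using a y_range[of n] partition_arc_iff[of "a n" "y n"]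
    unfolding B_symbolic_sequence_def arc_interval_def y_def by auto
  have step: "real (d (a n) (a (Suc n))) = K * H (y n) + H (y (Suc n))" for n
  proof -
    have "\<lfloor>F (y n)\<rfloor> = - int (d (a n) (a (Suc n)))"
      using y_piece[of n] y_piece[of "Suc n"] y_range[of n] unfolding y_Suc by (intro floor_F)
    moreover have "H (y (Suc n)) = - K * H (y n) - of_int \<lfloor>F (y n)\<rfloor>"
      using H_shift[of "F (y n)" "- \<lfloor>F (y n)\<rfloor>"]
      by (simp add: y_Suc frac_def H_functional K_def)
    ultimately show ?thesis by simp
  qed
  have partial_sum: "(\<Sum>n<N. real (d (a n) (a (Suc n))) * (- (1 / K)) ^ n)
      = K * H x - K * H (y N) * (- (1 / K)) ^ N" for N
  proof (induction N)
    case 0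
    show ?case by (simp add: y_def)
  next
    case (Suc N)
    have "(K * u + v) * c - K * u * c = - (K * v * (- (1 / K) * c))" for u v c
      using \<open>K > 1\<close> by (simp add: field_simps)
    from this[of "H (y N)" "H (y (Suc N))" "(- (1 / K)) ^ N"] show ?case
      using Suc.IH by (simp only: sum.lessThan_Suc step power_Suc)
  qed
  have "(\<lambda>N. K * H (y N) * (- (1 / K)) ^ N) \<longlonglongrightarrow> 0"
  proof (rule Lim_null_comparison)
    have "\<bar>1 / K\<bar> < 1"
      using \<open>K > 1\<close> by simp
    then show "(\<lambda>N. K * (1 / K) ^ N) \<longlonglongrightarrow> 0"
      by (intro tendsto_mult_right_zero LIMSEQ_power_zero) simp
    have "norm (K * H (y N) * (- (1 / K)) ^ N) \<le> K * (1 / K) ^ N" for N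
    proof -
      have "norm (K * H (y N) * (- (1 / K)) ^ N) = K * \<bar>H (y N)\<bar> * (1 / K) ^ N"
        using \<open>K > 1\<close> by (simp add: abs_mult power_abs)
      also have "\<dots> \<le> K * 1 * (1 / K) ^ N"
        using \<open>K > 1\<close> H_range[OF y_range[of N]] by (intro mult_right_mono mult_left_mono) simp_all
      finally show ?thesis by simp
    qed
    then show "\<forall>\<^sub>F N in sequentially. norm (K * H (y N) * (- (1 / K)) ^ N) \<le> K * (1 / K) ^ N"
      by (rule always_eventually[OF allI])
  qed
  from tendsto_diff[OF tendsto_const[of "K * H x"] this]
  have "(\<lambda>N. \<Sum>n<N. real (d (a n) (a (Suc n))) * (- (1 / K)) ^ n) \<longlonglongrightarrow> K * H x"
    unfolding partial_sum by simp
  then show ?thesis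
    by (simp add: sums_def K_def)
qed

end

theorem theorem9p4:
  fixes m :: nat and t :: "nat \<Rightarrow> int ^ 3" and \<theta> :: "nat \<Rightarrow> complex"
    and x :: real and a :: "nat \<Rightarrow> nat"
  assumes "unimodular_partition m t"
    and "\<And>i. \<theta> i = circle_point (t i)"
    and "x \<in> {0..<1}"
    and "B_symbolic_sequence m \<theta> x a"
  shows "summable (\<lambda>n. real (d (a n) (a (n + 1))) * (- (1 / (real m - 1))) ^ n) \<and>
         Phi m \<theta> x =
           1 / (real m - 1) *
           (\<Sum>n. real (d (a n) (a (n + 1))) * (- (1 / (real m - 1))) ^ n)"
proof -
  interpret circle_partition m t \<theta>
    using assms(1,2) by unfold_locales auto
  note series = H_series[OF assms(3,4)]
  have "real m - 1 \<noteq> 0"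
    using m_ge_3 by simp
  then have "Phi m \<theta> x = 1 / (real m - 1) * ((real m - 1) * H x)"
    using Phi_eq_H[OF assms(3)] by simp
  with series show ?thesis
    by (simp only: sums_iff)
qed

end
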